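(* Let $H$ be a separable Hilbert space, $1\le p<\infty$, and $S$ a bounded linear operator on $H$ (not assumed compact). The following are equivalent: (i) $S\in S_p$; (ii) there is a constant $C>0$ with $\sum_{n=1}^\infty|\langle Se_n,e_n\rangle|^p\le C$ for every orthonormal basis $\{e_n\}$; (iii) there is a constant $C>0$ with $\sum_{n=1}^\infty|\langle Sf_n,f_n\rangle|^p\le C$ for every frame $\{f_n\}$ with upper frame bound at most $1$.
   Context: A sequence $\{f_n\}$ in $H$ is a frame if there are constants $0<C_1\le C_2$ such that $C_1\|f\|^2\le\sum_n|\langle f,f_n\rangle|^2\le C_2\|f\|^2$ for all $f\in H$. The upper frame bound is the infimum of all admissible $C_2$. For a compact operator $T$, its singular values $\lambda_1\ge\lambda_2\ge\cdots$ are the positive eigenvalues of $(T^*T)^{1/2}$, repeated according to multiplicity. For $0<p<\infty$, $S_p$ is the set of compact $T$ with $\{\lambda_n\}\in\ell^p$. *)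

theory Defs
  imports "HOL-Analysis.Analysis"
begin

class complex_vector = real_vector +
  fixes scaleC :: "complex \<Rightarrow> 'a \<Rightarrow> 'a" (infixr "*\<^sub>C" 75)
  assumes scaleC_add_right: "a *\<^sub>C (x + y) = a *\<^sub>C x + a *\<^sub>C y"
    and scaleC_add_left: "(a + b) *\<^sub>C x = a *\<^sub>C x + b *\<^sub>C x"
    and scaleC_scaleC: "a *\<^sub>C (b *\<^sub>C x) = (a * b) *\<^sub>C x"
    and scaleC_one: "1 *\<^sub>C x = x"
    and scaleR_scaleC: "scaleR r x = complex_of_real r *\<^sub>C x"

class complex_normed_vector = complex_vector + real_normed_vector +
  assumes norm_scaleC: "norm (a *\<^sub>C x) = cmod a * norm x"

class complex_inner = complex_normed_vector +
  fixes cinner :: "'a \<Rightarrow> 'a \<Rightarrow> complex"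
  assumes cinner_commute: "cinner x y = cnj (cinner y x)"
    and cinner_add_left: "cinner (x + y) z = cinner x z + cinner y z"
    and cinner_scaleC_left: "cinner (r *\<^sub>C x) y = r * cinner x y"
    and cinner_nonneg: "Im (cinner x x) = 0 \<and> 0 \<le> Re (cinner x x)"
    and cinner_eq_zero_iff: "cinner x x = 0 \<longleftrightarrow> x = 0"
    and norm_eq_sqrt_cinner: "norm x = sqrt (Re (cinner x x))"

class chilbert_space = complex_inner + complete_space

definition clinear :: "('a::complex_vector \<Rightarrow> 'b::complex_vector) \<Rightarrow> bool" where
  "clinear T \<longleftrightarrow> (\<forall>x y. T (x + y) = T x + T y) \<and> (\<forall>c x. T (c *\<^sub>C x) = c *\<^sub>C T x)"

definition bounded_clinear :: "('a::complex_normed_vector \<Rightarrow> 'b::complex_normed_vector) \<Rightarrow> bool" where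
  "bounded_clinear T \<longleftrightarrow> clinear T \<and> (\<exists>K. \<forall>x. norm (T x) \<le> norm x * K)"

definition compact_op :: "('a::complex_normed_vector \<Rightarrow> 'b::complex_normed_vector) \<Rightarrow> bool" where
  "compact_op T \<longleftrightarrow> bounded_clinear T \<and> compact (closure (T ` cball 0 1))"

definition adjoint :: "('a::complex_inner \<Rightarrow> 'a) \<Rightarrow> ('a \<Rightarrow> 'a)" where
  "adjoint T = (THE T'. \<forall>x y. cinner (T x) y = cinner x (T' y))"

definition positive_op :: "('a::complex_inner \<Rightarrow> 'a) \<Rightarrow> bool" where
  "positive_op R \<longleftrightarrow> bounded_clinear R \<and> (\<forall>x. Im (cinner (R x) x) = 0 \<and> 0 \<le> Re (cinner (R x) x))"

definition abs_op :: "('a::complex_inner \<Rightarrow> 'a) \<Rightarrow> ('a \<Rightarrow> 'a)" where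
  "abs_op T = (THE R. positive_op R \<and> R \<circ> R = adjoint T \<circ> T)"

definition cspan :: "'a::complex_vector set \<Rightarrow> 'a set" where
  "cspan B = {\<Sum>e\<in>F. c e *\<^sub>C e | F c. finite F \<and> F \<subseteq> B}"

definition orthonormal :: "'a::complex_inner set \<Rightarrow> bool" where
  "orthonormal B \<longleftrightarrow> (\<forall>e\<in>B. cinner e e = 1) \<and> (\<forall>e\<in>B. \<forall>f\<in>B. e \<noteq> f \<longrightarrow> cinner e f = 0)"

definition is_onb :: "'a::complex_inner set \<Rightarrow> bool" where
  "is_onb B \<longleftrightarrow> orthonormal B \<and> closure (cspan B) = UNIV"

definition upper_admissible :: "(nat \<Rightarrow> 'a::complex_inner) \<Rightarrow> real \<Rightarrow> bool" where
  "upper_admissible f C2 \<longleftrightarrow> 0 < C2 \<and>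
     (\<forall>x. summable (\<lambda>n. (cmod (cinner x (f n)))\<^sup>2) \<and>
          (\<Sum>n. (cmod (cinner x (f n)))\<^sup>2) \<le> C2 * (norm x)\<^sup>2)"

definition is_frame :: "(nat \<Rightarrow> 'a::complex_inner) \<Rightarrow> bool" where
  "is_frame f \<longleftrightarrow> (\<exists>C1 C2. 0 < C1 \<and> C1 \<le> C2 \<and>
     (\<forall>x. summable (\<lambda>n. (cmod (cinner x (f n)))\<^sup>2) \<and>
          C1 * (norm x)\<^sup>2 \<le> (\<Sum>n. (cmod (cinner x (f n)))\<^sup>2) \<and>
          (\<Sum>n. (cmod (cinner x (f n)))\<^sup>2) \<le> C2 * (norm x)\<^sup>2))"

definition upper_frame_bound :: "(nat \<Rightarrow> 'a::complex_inner) \<Rightarrow> real" where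
  "upper_frame_bound f = Inf {C2. upper_admissible f C2}"

text \<open>s is the sequence of positive eigenvalues of abs_op T in non-increasing order,
  each repeated according to its (finite) multiplicity, padded with zeros if there
  are only finitely many.\<close>
definition singular_value_seq :: "('a::complex_inner \<Rightarrow> 'a) \<Rightarrow> (nat \<Rightarrow> real) \<Rightarrow> bool" where
  "singular_value_seq T s \<longleftrightarrow> antimono s \<and> (\<forall>n. 0 \<le> s n) \<and>
     (\<forall>\<mu>>0. finite {n. s n = \<mu>} \<and>
        (\<exists>B. finite B \<and> orthonormal B \<and> card B = card {n. s n = \<mu>} \<and>
             cspan B = {x. abs_op T x = complex_of_real \<mu> *\<^sub>C x}))"

definition schatten :: "real \<Rightarrow> ('a::complex_inner \<Rightarrow> 'a) set" where
  "schatten p = {T. compact_op T \<and> (\<exists>s. singular_value_seq T s \<and> summable (\<lambda>n. s n powr p))}"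

end

theory Submission
  imports Defs
begin

text \<open>
  A compact operator S has a singular value decomposition: maximize the norm of S x over the unit
  ball, then over the orthogonal complement of the maximizer, and so on. This yields orthonormal
  u n, v n with S x = (SUM n. s n <x, u n> v n), and the s n are the singular values of S.

  (i) implies (iii): if f has upper frame bound at most 1, the matrix |<f k, u n>| |<v n, f k>| is
  doubly substochastic, so Jensen's inequality bounds the sum over k of |<S (f k), f k>|^p by the
  sum of the (s n)^p. (iii) implies (ii) because an orthonormal basis is a Parseval frame.

  (ii) implies (i): the Hermitian parts of the form <S x, y> inherit (ii). Diagonalizing
  their compressions to finite-dimensional subspaces and using the same matrix argument, the sums of
  |<S (u k), v k>|^p are uniformly bounded over all pairs of orthonormal sequences u, v. Hence for
  every \<epsilon> > 0 there is no infinite orthonormal pair with |<S (u k), v k>| > \<epsilon>, so S is a norm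
  limit of finite rank operators; being compact, it has a singular value decomposition, along which
  |<S (u k), v k>| = s k.
\<close>

section \<open>Complex inner product spaces\<close>

text \<open>The obstacle lies in using (ii): there the same vector stands on both sides of <S e, e>,
  whereas singular values are read off from pairs u k, v k. Polarizing <S (u k), v k> directly
  leaves the orthonormal systems, because the vectors u k + v k are in general not orthogonal for
  different k. A Hermitian form escapes this: in a basis that diagonalizes it on a
  finite-dimensional subspace, its diagonal entries determine all its values. As S is not yet known
  to be compact, only compressions can be diagonalized, and the bound must not depend on the
  subspace. The diagonalization is itself drawn from the singular value decomposition: a shift makes
  the compression positive, and for a positive operator left and right singular vectors agree.
  Singular values are defined through a definite description of the absolute value of S and through
  dimensions of eigenspaces. A decomposition therefore yields them only together with the uniqueness
  of positive square roots and the invariance of dimension.\<close>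

instance chilbert_space \<subseteq> banach ..

interpretation scaleC: bounded_bilinear "scaleC :: complex \<Rightarrow> 'a::complex_normed_vector \<Rightarrow> 'a"
proof
  fix a b :: complex and x y :: 'a and r :: real
  show "(a + b) *\<^sub>C x = a *\<^sub>C x + b *\<^sub>C x" by (rule scaleC_add_left)
  show "a *\<^sub>C (x + y) = a *\<^sub>C x + a *\<^sub>C y" by (rule scaleC_add_right)
  show "(r *\<^sub>R a) *\<^sub>C x = r *\<^sub>R (a *\<^sub>C x)"
    by (simp add: scaleR_scaleC scaleC_scaleC scaleR_conv_of_real)
  show "a *\<^sub>C (r *\<^sub>R x) = r *\<^sub>R (a *\<^sub>C x)"
    by (simp add: scaleR_scaleC scaleC_scaleC mult.commute)
  show "\<exists>K. \<forall>(a::complex) (x::'a). norm (a *\<^sub>C x) \<le> norm a * norm x * K"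
    by (rule exI[of _ 1]) (simp add: norm_scaleC)
qed

lemma cinner_add_right: "cinner x (y + z) = cinner x y + cinner x z" for x :: "'a::complex_inner"
  by (metis cinner_add_left cinner_commute complex_cnj_add)

lemma cinner_scaleC_right: "cinner x (c *\<^sub>C y) = cnj c * cinner x y" for x :: "'a::complex_inner"
  by (metis cinner_scaleC_left cinner_commute complex_cnj_mult)

lemma cinner_self: "cinner x x = complex_of_real ((norm x)\<^sup>2)" for x :: "'a::complex_inner"
  using cinner_nonneg[of x] by (simp add: norm_eq_sqrt_cinner complex_eq_iff)

lemma norm_add_sq:
  "(norm (x + y))\<^sup>2 = (norm x)\<^sup>2 + 2 * Re (cinner x y) + (norm y)\<^sup>2" for x :: "'a::complex_inner"
proof -
  have "complex_of_real ((norm (x + y))\<^sup>2) = cinner x x + cinner x y + cinner y x + cinner y y"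
    by (simp only: cinner_self[symmetric] cinner_add_left cinner_add_right add_ac)
  then have "Re (complex_of_real ((norm (x + y))\<^sup>2)) = Re (cinner x x + cinner x y + cinner y x + cinner y y)"
    by simp
  moreover have "Re (cinner y x) = Re (cinner x y)" by (metis cinner_commute complex_cnj(1) cnj.sel(1))
  ultimately show ?thesis by (simp add: cinner_self)
qed

lemma cinner_zero_left': "cinner 0 y = 0" for y :: "'a::complex_inner"
  using cinner_add_left[of 0 0 y] by simp

lemma norm_cinner_le: "cmod (cinner x y) \<le> norm x * norm y" for x :: "'a::complex_inner"
proof (cases "y = 0")
  case True
  then show ?thesis using cinner_commute[of x y] by (simp add: cinner_zero_left')
next
  case False
  define w where "w = cinner x y"
  \<comment> \<open>The minimizer of the norm of x + t y: -t y is the projection of x onto the line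
    through y.\<close>
  define t where "t = - w / complex_of_real ((norm y)\<^sup>2)"
  have y: "norm y > 0" using False by simp
  have "0 \<le> (norm (x + t *\<^sub>C y))\<^sup>2" by simp
  also have "\<dots> = (norm x)\<^sup>2 + 2 * Re (cnj t * w) + (cmod t * norm y)\<^sup>2"
    by (simp add: norm_add_sq cinner_scaleC_right w_def norm_scaleC)
  also have "Re (cnj t * w) = - (cmod w)\<^sup>2 / (norm y)\<^sup>2"
  proof -
    have "cnj t * w = - (cnj w * w) / complex_of_real ((norm y)\<^sup>2)" by (simp add: t_def)
    also have "cnj w * w = complex_of_real ((cmod w)\<^sup>2)" by (metis complex_norm_square mult.commute)
    also have "- complex_of_real ((cmod w)\<^sup>2) / complex_of_real ((norm y)\<^sup>2)
      = complex_of_real (- (cmod w)\<^sup>2 / (norm y)\<^sup>2)" by simp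
    finally show ?thesis by (metis Re_complex_of_real)
  qed
  also have "(cmod t * norm y)\<^sup>2 = (cmod w)\<^sup>2 / (norm y)\<^sup>2"
    using y by (simp add: t_def norm_divide norm_mult norm_power power_mult_distrib power_divide power2_eq_square)
  finally have "(cmod w)\<^sup>2 / (norm y)\<^sup>2 \<le> (norm x)\<^sup>2" by simp
  then have "(cmod w)\<^sup>2 \<le> (norm x * norm y)\<^sup>2" using y by (simp add: divide_le_eq power_mult_distrib)
  then show ?thesis unfolding w_def by (rule power2_le_imp_le) simp
qed

text \<open>Conjugate-linearity in the second argument is still real linearity, so the real notion
  of a bounded bilinear map supplies continuity and compatibility with series in both
  arguments.\<close>

interpretation cinner: bounded_bilinear "cinner :: 'a::complex_inner \<Rightarrow> 'a \<Rightarrow> complex"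
proof
  fix x y z :: 'a and r :: real
  show "cinner (x + y) z = cinner x z + cinner y z" by (rule cinner_add_left)
  show "cinner x (y + z) = cinner x y + cinner x z" by (rule cinner_add_right)
  show "cinner (r *\<^sub>R x) y = r *\<^sub>R cinner x y"
    by (simp add: scaleR_scaleC cinner_scaleC_left scaleR_conv_of_real)
  show "cinner x (r *\<^sub>R y) = r *\<^sub>R cinner x y"
    by (simp add: scaleR_scaleC cinner_scaleC_right scaleR_conv_of_real)
  show "\<exists>K. \<forall>(x::'a) y. norm (cinner x y) \<le> norm x * norm y * K"
    by (rule exI[of _ 1]) (simp add: norm_cinner_le)
qed

declare scaleC.zero_left [simp] scaleC.zero_right [simp] scaleC_one [simp]
  cinner.zero_left [simp] cinner.zero_right [simp]

lemma cinner_zero_commute: "cinner x y = 0 \<longleftrightarrow> cinner y x = 0" for x :: "'a::complex_inner"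
  by (metis cinner_commute complex_cnj_zero)

lemma norm_cinner_commute: "cmod (cinner x y) = cmod (cinner y x)" for x :: "'a::complex_inner"
  by (metis cinner_commute complex_mod_cnj)

lemma cinner_eqI: "(\<And>z. cinner x z = cinner y z) \<Longrightarrow> x = y" for x :: "'a::complex_inner"
  by (metis cinner.diff_left cinner_eq_zero_iff eq_iff_diff_eq_0)

lemma norm_add_orthogonal:
  "cinner x y = 0 \<Longrightarrow> (norm (x + y))\<^sup>2 = (norm x)\<^sup>2 + (norm y)\<^sup>2" for x :: "'a::complex_inner"
  by (simp add: norm_add_sq)

lemma parallelogram:
  "(norm (x - y))\<^sup>2 = 2 * (norm x)\<^sup>2 + 2 * (norm y)\<^sup>2 - (norm (x + y))\<^sup>2" for x :: "'a::complex_inner"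
  using norm_add_sq[of x y] norm_add_sq[of x "- y"] by (simp add: cinner.minus_right)

lemma bounded_clinear_imp_bounded_linear: "bounded_clinear T \<Longrightarrow> bounded_linear T"
proof -
  assume T: "bounded_clinear T"
  then obtain K where "\<forall>x. norm (T x) \<le> norm x * K" by (auto simp: bounded_clinear_def)
  with T show "bounded_linear T"
    by (intro bounded_linear_intro[where K = K]) (simp_all add: bounded_clinear_def clinear_def scaleR_scaleC)
qed

lemma bounded_clinear_pos_bound:
  assumes "bounded_clinear T"
  obtains K where "K > 0" "\<And>x. norm (T x) \<le> K * norm x"
  using bounded_linear.pos_bounded[OF bounded_clinear_imp_bounded_linear[OF assms]]
  by (metis mult.commute)

lemma bounded_clinear_scaleC: "bounded_clinear T \<Longrightarrow> T (c *\<^sub>C x) = c *\<^sub>C T x"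
  by (simp add: bounded_clinear_def clinear_def)

section \<open>Orthonormal and Bessel sequences\<close>

text \<open>Zero entries pad finite orthonormal families to sequences.\<close>
definition on_seq :: "(nat \<Rightarrow> 'a::complex_inner) \<Rightarrow> bool" where
  "on_seq f \<longleftrightarrow> (\<forall>i j. i \<noteq> j \<longrightarrow> cinner (f i) (f j) = 0) \<and> (\<forall>i. f i = 0 \<or> norm (f i) = 1)"

text \<open>The common generalization of orthonormal sequences and of frames with upper bound at
  most 1. Bounding partial sums makes summability a consequence instead of a further clause.\<close>

definition bessel_seq :: "(nat \<Rightarrow> 'a::complex_inner) \<Rightarrow> bool" where
  "bessel_seq f \<longleftrightarrow> (\<forall>x N. (\<Sum>n<N. (cmod (cinner x (f n)))\<^sup>2) \<le> (norm x)\<^sup>2)"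

lemma on_seq_cinner_self: "on_seq f \<Longrightarrow> cinner (f i) (f i) = (if f i = 0 then 0 else 1)"
  by (auto simp: on_seq_def cinner_self)

lemma on_seq_cinner: "on_seq f \<Longrightarrow> cinner (f i) (f j) = (if i = j \<and> f i \<noteq> 0 then 1 else 0)"
  using on_seq_cinner_self[of f i] by (auto simp: on_seq_def)

lemma on_seq_norm_le: "on_seq f \<Longrightarrow> norm (f i) \<le> 1"
  unfolding on_seq_def by (metis norm_zero order_refl zero_le_one)

lemma on_seq_scaleC_cinner_self: "on_seq f \<Longrightarrow> cinner (f i) (f i) *\<^sub>C f i = f i"
  by (simp add: on_seq_cinner_self)

lemma on_seq_norm_sum:
  assumes "on_seq f" "finite F"
  shows "(norm (\<Sum>i\<in>F. c i *\<^sub>C f i))\<^sup>2 = (\<Sum>i\<in>F. (cmod (c i) * norm (f i))\<^sup>2)"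
  using assms(2)
proof (induction F)
  case (insert j F)
  have "cinner (c j *\<^sub>C f j) (\<Sum>i\<in>F. c i *\<^sub>C f i) = 0"
    unfolding cinner.sum_right
  proof (rule sum.neutral, rule ballI)
    fix i assume "i \<in> F"
    with insert.hyps have "j \<noteq> i" by blast
    with assms(1) have "cinner (f j) (f i) = 0" by (simp add: on_seq_def)
    then show "cinner (c j *\<^sub>C f j) (c i *\<^sub>C f i) = 0"
      by (simp add: cinner_scaleC_left cinner_scaleC_right)
  qed
  then show ?case using insert by (simp add: norm_add_orthogonal norm_scaleC)
qed simp

lemma on_seq_norm_sum_le:
  assumes "on_seq f" "finite F"
  shows "(norm (\<Sum>i\<in>F. c i *\<^sub>C f i))\<^sup>2 \<le> (\<Sum>i\<in>F. (cmod (c i))\<^sup>2)"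
  unfolding on_seq_norm_sum[OF assms]
proof (rule sum_mono)
  fix i
  have "cmod (c i) * norm (f i) \<le> cmod (c i) * 1"
    by (rule mult_left_mono[OF on_seq_norm_le[OF assms(1)]]) simp
  then show "(cmod (c i) * norm (f i))\<^sup>2 \<le> (cmod (c i))\<^sup>2" by (simp add: power_mono)
qed

lemma on_seq_imp_bessel_seq:
  assumes f: "on_seq f"
  shows "bessel_seq f"
  unfolding bessel_seq_def
proof (intro allI)
  fix x :: 'a and N :: nat
  define y where "y = (\<Sum>n<N. cinner x (f n) *\<^sub>C f n)"
  have *: "cinner x (f n) * cnj (cinner x (f n)) = (cmod (cinner x (f n)))\<^sup>2" for n
    by (simp only: complex_norm_square)
  have "cinner x y = complex_of_real (\<Sum>n<N. (cmod (cinner x (f n)))\<^sup>2)"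
    unfolding y_def cinner.sum_right cinner_scaleC_right of_real_sum
    by (intro sum.cong refl) (metis * mult.commute)
  then have xy: "Re (cinner x y) = (\<Sum>n<N. (cmod (cinner x (f n)))\<^sup>2)" by simp
  have yy: "(norm y)\<^sup>2 \<le> (\<Sum>n<N. (cmod (cinner x (f n)))\<^sup>2)"
    unfolding y_def by (rule on_seq_norm_sum_le[OF f]) simp
  have "0 \<le> (norm (x + - y))\<^sup>2" by simp
  also have "\<dots> = (norm x)\<^sup>2 - 2 * Re (cinner x y) + (norm y)\<^sup>2"
    unfolding norm_add_sq by (simp add: cinner.minus_right)
  finally show "(\<Sum>n<N. (cmod (cinner x (f n)))\<^sup>2) \<le> (norm x)\<^sup>2" using xy yy by linarith
qed

lemma bessel_seq_summable: "bessel_seq f \<Longrightarrow> summable (\<lambda>n. (cmod (cinner x (f n)))\<^sup>2)"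
  by (rule summableI_nonneg_bounded[where x = "(norm x)\<^sup>2"]) (auto simp: bessel_seq_def)

text \<open>Testing the Bessel bound at x = f n and keeping only the n-th term gives that the fourth
  power of the norm is at most its square.\<close>

lemma bessel_seq_norm_le:
  assumes "bessel_seq f"
  shows "norm (f n) \<le> 1"
proof -
  have "(cmod (cinner (f n) (f n)))\<^sup>2 \<le> (\<Sum>k<Suc n. (cmod (cinner (f n) (f k)))\<^sup>2)"
    by (rule member_le_sum) auto
  also have "\<dots> \<le> (norm (f n))\<^sup>2" using assms unfolding bessel_seq_def by blast
  finally have *: "((norm (f n))\<^sup>2)\<^sup>2 \<le> (norm (f n))\<^sup>2" by (simp add: cinner_self norm_power)
  show ?thesis
  proof (rule ccontr)
    assume "\<not> norm (f n) \<le> 1"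
    then have "1 < (norm (f n))\<^sup>2" by (simp add: one_less_power)
    then have "(norm (f n))\<^sup>2 * 1 < (norm (f n))\<^sup>2 * (norm (f n))\<^sup>2"
      by (intro mult_strict_left_mono) auto
    with * show False by (simp add: power2_eq_square)
  qed
qed

lemma bessel_seq_sum_le_one:
  "bessel_seq f \<Longrightarrow> norm x \<le> 1 \<Longrightarrow> (\<Sum>n<N. (cmod (cinner x (f n)))\<^sup>2) \<le> 1"
  unfolding bessel_seq_def by (meson order_trans norm_ge_zero power_le_one)

lemma on_seq_summable:
  fixes f :: "nat \<Rightarrow> 'a::chilbert_space"
  assumes f: "on_seq f" and c: "summable (\<lambda>n. (cmod (c n))\<^sup>2)"
  shows "summable (\<lambda>n. c n *\<^sub>C f n)"
  unfolding summable_Cauchy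
proof (intro allI impI)
  fix e :: real assume "0 < e"
  then have "0 < e\<^sup>2" by simp
  then obtain N where N: "\<And>m n. m \<ge> N \<Longrightarrow> norm (\<Sum>i\<in>{m..<n}. (cmod (c i))\<^sup>2) < e\<^sup>2"
    using c unfolding summable_Cauchy by blast
  have "norm (\<Sum>i\<in>{m..<n}. c i *\<^sub>C f i) < e" if "m \<ge> N" for m n
  proof -
    have "(norm (\<Sum>i\<in>{m..<n}. c i *\<^sub>C f i))\<^sup>2 \<le> (\<Sum>i\<in>{m..<n}. (cmod (c i))\<^sup>2)"
      by (rule on_seq_norm_sum_le[OF f]) simp
    also have "\<dots> < e\<^sup>2" using N[OF that, of n] by simp
    finally show ?thesis using \<open>0 < e\<close> by (simp add: power_less_imp_less_base)
  qed
  then show "\<exists>N. \<forall>m\<ge>N. \<forall>n. norm (\<Sum>i\<in>{m..<n}. c i *\<^sub>C f i) < e" by blast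
qed

section \<open>Diagonal operators between two orthonormal sequences\<close>

lemma cinner_sums_left: "f sums x \<Longrightarrow> (\<lambda>n. cinner (f n) y) sums cinner x y"
  by (rule bounded_linear.sums[OF cinner.bounded_linear_left])

text \<open>The operator SUM n. s n <., u n> w n. Real weights make its adjoint the same operator
  with \<open>u\<close> and \<open>w\<close> exchanged; with \<open>w = u\<close> and all weights 1
  it is the projection onto the closed span of \<open>u\<close>.\<close>

definition diag_op ::
  "(nat \<Rightarrow> real) \<Rightarrow> (nat \<Rightarrow> 'a) \<Rightarrow> (nat \<Rightarrow> 'a) \<Rightarrow> 'a \<Rightarrow> 'a::chilbert_space" where
  "diag_op s u w x = (\<Sum>n. (complex_of_real (s n) * cinner x (u n)) *\<^sub>C w n)"

lemma diag_op_sums: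
  assumes u: "on_seq u" and w: "on_seq w" and s: "\<forall>n. \<bar>s n\<bar> \<le> M"
  shows "(\<lambda>n. (complex_of_real (s n) * cinner x (u n)) *\<^sub>C w n) sums diag_op s u w x"
  unfolding diag_op_def
proof (rule summable_sums, rule on_seq_summable[OF w])
  show "summable (\<lambda>n. (cmod (complex_of_real (s n) * cinner x (u n)))\<^sup>2)"
  proof (rule summable_comparison_test')
    show "summable (\<lambda>n. M\<^sup>2 * (cmod (cinner x (u n)))\<^sup>2)"
      by (intro summable_mult bessel_seq_summable on_seq_imp_bessel_seq u)
    have "(s n)\<^sup>2 \<le> M\<^sup>2" for n using power_mono[OF s[rule_format, of n], of 2] by simp
    then show "norm ((cmod (complex_of_real (s n) * cinner x (u n)))\<^sup>2) \<le> M\<^sup>2 * (cmod (cinner x (u n)))\<^sup>2"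
      for n by (simp add: norm_mult power_mult_distrib mult_right_mono)
  qed
qed

lemma cinner_diag_op_sums:
  assumes "on_seq u" "on_seq w" "\<forall>n. \<bar>s n\<bar> \<le> M"
  shows "(\<lambda>n. complex_of_real (s n) * cinner x (u n) * cinner (w n) y) sums cinner (diag_op s u w x) y"
  using cinner_sums_left[OF diag_op_sums[OF assms]] by (simp add: cinner_scaleC_left)

text \<open>The last factor is 1 for a genuine entry of \<open>w\<close> and 0 for a padding
  entry.\<close>

lemma cinner_diag_op_right:
  assumes "on_seq u" "on_seq w" "\<forall>n. \<bar>s n\<bar> \<le> M"
  shows "cinner (diag_op s u w x) (w n) = complex_of_real (s n) * cinner x (u n) * cinner (w n) (w n)"
proof -
  have "(\<lambda>k. complex_of_real (s k) * cinner x (u k) * cinner (w k) (w n)) sums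
        (complex_of_real (s n) * cinner x (u n) * cinner (w n) (w n))"
    by (rule sums_finite[of "{n}", THEN sums_cong[THEN iffD1, rotated], simplified])
      (use assms(2) in \<open>auto simp: on_seq_def\<close>)
  with cinner_diag_op_sums[OF assms, where y = "w n" and x = x] show ?thesis by (rule sums_unique2)
qed

lemma clinear_diag_op:
  assumes "on_seq u" "on_seq w" "\<forall>n. \<bar>s n\<bar> \<le> M"
  shows "clinear (diag_op s u w)"
  unfolding clinear_def
proof (intro conjI allI)
  fix x y :: 'a and c :: complex
  note sums = diag_op_sums[OF assms]
  show "diag_op s u w (x + y) = diag_op s u w x + diag_op s u w y"
    using sums_unique2[OF sums[of "x + y"], of "diag_op s u w x + diag_op s u w y"]
      sums_add[OF sums[of x] sums[of y]]
    by (simp add: cinner_add_left distrib_left scaleC_add_left)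
  have "(\<lambda>n. c *\<^sub>C ((complex_of_real (s n) * cinner x (u n)) *\<^sub>C w n)) sums (c *\<^sub>C diag_op s u w x)"
    by (rule bounded_linear.sums[OF scaleC.bounded_linear_right sums])
  then show "diag_op s u w (c *\<^sub>C x) = c *\<^sub>C diag_op s u w x"
    using sums_unique2[OF sums[of "c *\<^sub>C x"], of "c *\<^sub>C diag_op s u w x"]
    by (simp add: cinner_scaleC_left scaleC_scaleC mult_ac)
qed

lemma norm_diag_op_le:
  fixes x :: "'a::chilbert_space"
  assumes "on_seq u" "on_seq w" "\<forall>n. \<bar>s n\<bar> \<le> M"
  shows "norm (diag_op s u w x) \<le> norm x * M"
proof -
  have M: "0 \<le> M" using assms(3)[rule_format, of 0] by linarith
  have "norm (\<Sum>n<N. (complex_of_real (s n) * cinner x (u n)) *\<^sub>C w n) \<le> norm x * M" for N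
  proof (rule power2_le_imp_le)
    have "(norm (\<Sum>n<N. (complex_of_real (s n) * cinner x (u n)) *\<^sub>C w n))\<^sup>2
        \<le> (\<Sum>n<N. (cmod (complex_of_real (s n) * cinner x (u n)))\<^sup>2)"
      by (rule on_seq_norm_sum_le[OF assms(2)]) simp
    also have "\<dots> \<le> (\<Sum>n<N. M\<^sup>2 * (cmod (cinner x (u n)))\<^sup>2)"
    proof (rule sum_mono)
      fix n
      have "(s n)\<^sup>2 \<le> M\<^sup>2" using power_mono[OF assms(3)[rule_format, of n], of 2] by simp
      then show "(cmod (complex_of_real (s n) * cinner x (u n)))\<^sup>2 \<le> M\<^sup>2 * (cmod (cinner x (u n)))\<^sup>2"
        by (simp add: norm_mult power_mult_distrib mult_right_mono)
    qed
    also have "\<dots> \<le> M\<^sup>2 * (norm x)\<^sup>2"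
      using on_seq_imp_bessel_seq[OF assms(1)]
      by (simp add: sum_distrib_left[symmetric] bessel_seq_def mult_left_mono)
    finally show "(norm (\<Sum>n<N. (complex_of_real (s n) * cinner x (u n)) *\<^sub>C w n))\<^sup>2 \<le> (norm x * M)\<^sup>2"
      by (simp add: power_mult_distrib mult.commute)
  qed (use M in simp)
  with diag_op_sums[OF assms, of x] show ?thesis
    unfolding sums_def by (intro LIMSEQ_le_const2[OF tendsto_norm]) auto
qed

lemma bounded_clinear_diag_op:
  assumes "on_seq u" "on_seq w" "\<forall>n. \<bar>s n\<bar> \<le> M"
  shows "bounded_clinear (diag_op s u w)"
  unfolding bounded_clinear_def using clinear_diag_op[OF assms] norm_diag_op_le[OF assms] by blast

text \<open>\<open>y\<close> is the projection of \<open>x\<close> onto the closed span of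
  \<open>u\<close>, obtained as \<open>diag_op\<close> with all weights 1; completeness of the space
  enters through the convergence of that series.\<close>

lemma on_seq_decompose:
  fixes u :: "nat \<Rightarrow> 'a::chilbert_space"
  assumes "on_seq u"
  obtains y z where "x = y + z" "(\<lambda>n. cinner x (u n) *\<^sub>C u n) sums y" "\<And>n. cinner z (u n) = 0"
proof -
  define y where "y = diag_op (\<lambda>_. 1) u u x"
  have y: "(\<lambda>n. cinner x (u n) *\<^sub>C u n) sums y"
    using diag_op_sums[OF assms assms, of "\<lambda>_. 1" 1 x] by (simp add: y_def)
  have yn: "cinner y (u n) = cinner x (u n)" for n
    using cinner_diag_op_right[OF assms assms, of "\<lambda>_. 1" 1 x n]
    by (cases "u n = 0") (auto simp: y_def on_seq_cinner_self[OF assms] cinner.zero_right)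
  show ?thesis
    by (rule that[of y "x - y"]) (use y in \<open>simp_all add: cinner.diff_left yn\<close>)
qed

section \<open>Singular value decomposition of compact operators\<close>

lemma compact_op_convergent_subseq:
  fixes x :: "nat \<Rightarrow> 'a::complex_normed_vector"
  assumes "compact_op S" "\<And>n. norm (x n) \<le> 1"
  obtains y r where "strict_mono r" "(\<lambda>n. S (x (r n))) \<longlonglongrightarrow> y"
proof -
  have "compact (closure (S ` cball 0 1))" using assms(1) by (simp add: compact_op_def)
  moreover have "\<forall>n. S (x n) \<in> closure (S ` cball 0 1)"
    using assms(2) by (auto intro!: closure_subset[THEN subsetD] imageI)
  ultimately obtain y r where "strict_mono r" "((\<lambda>n. S (x n)) \<circ> r) \<longlonglongrightarrow> y"
    using seq_compactE[where f = "\<lambda>n. S (x n)"] by (metis compact_imp_seq_compact)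
  then show ?thesis using that by (simp add: o_def)
qed

text \<open>No weak compactness is needed: by the parallelogram law, a maximizing sequence whose
  images converge is itself Cauchy.\<close>
lemma compact_op_attains_norm:
  fixes S :: "'a::chilbert_space \<Rightarrow> 'a"
  assumes S: "compact_op S" and "closed W"
    and add: "\<And>x y. x \<in> W \<Longrightarrow> y \<in> W \<Longrightarrow> x + y \<in> W"
    and scale: "\<And>x r. x \<in> W \<Longrightarrow> r *\<^sub>R x \<in> W"
    and nz: "w \<in> W" "S w \<noteq> 0"
  obtains x where "x \<in> W" "norm x = 1" "S x \<noteq> 0" "\<And>y. y \<in> W \<Longrightarrow> norm (S y) \<le> norm (S x) * norm y"
proof -
  have blS: "bounded_linear S" using S by (simp add: compact_op_def bounded_clinear_imp_bounded_linear)
  then interpret S: bounded_linear S .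
  obtain K where K: "K > 0" "\<And>x. norm (S x) \<le> K * norm x"
    using S by (auto simp: compact_op_def elim: bounded_clinear_pos_bound)
  define A where "A = (\<lambda>x. norm (S x)) ` (W \<inter> cball 0 1)"
  define M where "M = Sup A"
  have "norm (S x) \<le> K" if "norm x \<le> 1" for x
    using K(2)[of x] K(1) that by (metis mult.right_neutral mult_left_mono order_trans less_imp_le)
  then have bdd: "bdd_above A" by (auto simp: A_def intro!: bdd_aboveI2[where M = K])
  have w0: "w \<noteq> 0" using nz S.zero by auto
  define w' where "w' = (1 / norm w) *\<^sub>R w"
  have w': "w' \<in> W" "norm w' = 1" "S w' \<noteq> 0"
    using w0 nz scale by (auto simp: w'_def S.scaleR)
  then have "norm (S w') \<in> A" by (auto simp: A_def)
  then have "norm (S w') \<le> M" unfolding M_def using bdd by (rule cSup_upper)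
  moreover have "norm (S w') > 0" using w' by simp
  ultimately have M: "M > 0" by linarith
  have ball: "norm (S y) \<le> M" if "y \<in> W" "norm y \<le> 1" for y
    unfolding M_def using that bdd by (intro cSup_upper) (auto simp: A_def)
  have bound: "norm (S y) \<le> M * norm y" if "y \<in> W" for y
  proof (cases "y = 0")
    case False
    then have "norm (S ((1 / norm y) *\<^sub>R y)) \<le> M" using that scale by (intro ball) auto
    with False show ?thesis by (simp add: S.scaleR divide_le_eq)
  qed (simp add: S.zero)
  have "\<exists>x\<in>W. norm x \<le> 1 \<and> M - 1 / real (Suc n) < norm (S x)" for n
  proof -
    have "A \<noteq> {}" using \<open>norm (S w') \<in> A\<close> by blast
    moreover have "M - 1 / real (Suc n) < Sup A" by (simp add: M_def)
    ultimately obtain a where "a \<in> A" "M - 1 / real (Suc n) < a" using less_cSupD by blast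
    then show ?thesis by (auto simp: A_def)
  qed
  then obtain x where x: "\<And>n. x n \<in> W" "\<And>n. norm (x n) \<le> 1" "\<And>n. M - 1 / real (Suc n) < norm (S (x n))"
    by metis
  obtain y r where r: "strict_mono r" and lim: "(\<lambda>n. S (x (r n))) \<longlonglongrightarrow> y"
    using compact_op_convergent_subseq[where S = S and x = x, OF S] x(2) by metis
  have Mlim: "(\<lambda>n. norm (S (x n))) \<longlonglongrightarrow> M"
  proof (rule tendsto_sandwich[where f = "\<lambda>n. M - 1 / real (Suc n)" and h = "\<lambda>_. M"])
    show "(\<lambda>n. M - 1 / real (Suc n)) \<longlonglongrightarrow> M"
      using tendsto_diff[OF tendsto_const LIMSEQ_inverse_real_of_nat, of M] by (simp add: inverse_eq_divide)
  qed (use x ball in \<open>auto intro!: always_eventually less_imp_le\<close>)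
  have "(\<lambda>n. norm (S (x (r n)))) \<longlonglongrightarrow> M"
    using LIMSEQ_subseq_LIMSEQ[OF Mlim r] by (simp add: o_def)
  then have y: "norm y = M" using LIMSEQ_unique tendsto_norm[OF lim] by blast
  have "Cauchy (\<lambda>n. x (r n))"
  proof (rule metric_CauchyI)
    fix e :: real assume e: "0 < e"
    \<comment> \<open>With norm (a + b) > 2 - 2 d the parallelogram law bounds the squared distance
      of a and b by 4 - (2 - 2 d)^2 = 8 d - 4 d^2, hence the 8. The cap at 1 keeps 2 - 2 d
      nonnegative for squaring.\<close>
    define d where "d = min 1 (e\<^sup>2 / 8)"
    have d: "0 < d" "d \<le> 1" "8 * d \<le> e\<^sup>2" using e by (auto simp: d_def)
    have "0 < M * d" using M d by simp
    then obtain N where N: "\<And>n. n \<ge> N \<Longrightarrow> norm (S (x (r n)) - y) < M * d"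
      using lim unfolding LIMSEQ_iff by blast
    have "dist (x (r m)) (x (r n)) < e" if "m \<ge> N" "n \<ge> N" for m n
    proof -
      let ?a = "x (r m)" and ?b = "x (r n)"
      \<comment> \<open>Both images are within M d of \<open>y\<close>, so S (a + b) is close to 2
        y, whose norm is 2 M; the bound M on \<open>W\<close> then forces norm (a + b) to be close
        to 2.\<close>
      have "2 * M = norm (2 *\<^sub>R y)" using y by simp
      also have "2 *\<^sub>R y = S (?a + ?b) - ((S ?a - y) + (S ?b - y))"
        by (simp add: S.add scaleR_2)
      also have "norm \<dots> \<le> norm (S (?a + ?b)) + (norm (S ?a - y) + norm (S ?b - y))"
        by (meson add_left_mono norm_triangle_ineq norm_triangle_ineq4 order_trans)
      also have "\<dots> < M * norm (?a + ?b) + (M * d + M * d)"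
        using bound[OF add[OF x(1) x(1)], of "r m" "r n"] N[OF that(1)] N[OF that(2)] by linarith
      finally have "M * 2 < M * (norm (?a + ?b) + 2 * d)" by (simp add: algebra_simps)
      then have "2 - 2 * d < norm (?a + ?b)" using M by (simp add: mult_less_cancel_left)
      then have "(2 - 2 * d)\<^sup>2 < (norm (?a + ?b))\<^sup>2" using d by (intro power_strict_mono) auto
      moreover have "(norm ?a)\<^sup>2 \<le> 1" "(norm ?b)\<^sup>2 \<le> 1" using x(2) by (auto intro: power_le_one)
      ultimately have "(norm (?a - ?b))\<^sup>2 < 4 - (2 - 2 * d)\<^sup>2"
        unfolding parallelogram by linarith
      also have "\<dots> = 8 * d - 4 * d\<^sup>2" by (simp add: power2_eq_square algebra_simps)
      also have "\<dots> \<le> e\<^sup>2" using d by (smt (verit) zero_le_power2)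
      finally show ?thesis using e by (simp add: dist_norm power_less_imp_less_base)
    qed
    then show "\<exists>N. \<forall>m\<ge>N. \<forall>n\<ge>N. dist (x (r m)) (x (r n)) < e" by blast
  qed
  then obtain z where z: "(\<lambda>n. x (r n)) \<longlonglongrightarrow> z"
    using Cauchy_convergent convergent_def by blast
  have zW: "z \<in> W" using \<open>closed W\<close> x(1) z by (meson closed_sequentially)
  have "norm z \<le> 1" using tendsto_norm[OF z] x(2) by (intro LIMSEQ_le_const2) auto
  have "(\<lambda>n. S (x (r n))) \<longlonglongrightarrow> S z" using S.tendsto[OF z] .
  then have "S z = y" using LIMSEQ_unique lim by blast
  then have Sz: "norm (S z) = M" using y by simp
  have "M \<le> M * norm z" using bound[OF zW] Sz by simp
  then have "norm z = 1" using M \<open>norm z \<le> 1\<close> by (simp add: mult_le_cancel_left)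
  with zW Sz M bound show ?thesis by (intro that[of z]) auto
qed

text \<open>First variation: if S x and S y were not orthogonal, moving from x along a small
  multiple of y would change the norm of the image to first order, but the norm of the vector only
  to second order.\<close>

lemma maximizer_orthogonal:
  fixes S :: "'a::complex_inner \<Rightarrow> 'a"
  assumes S: "clinear S" and "norm x = 1" and xy: "cinner y x = 0"
    and max: "\<And>t. norm (S (x + t *\<^sub>C y)) \<le> norm (S x) * norm (x + t *\<^sub>C y)"
  shows "cinner (S y) (S x) = 0"
proof (rule ccontr)
  define w where "w = cinner (S x) (S y)"
  assume "cinner (S y) (S x) \<noteq> 0"
  then have w: "cmod w > 0" using cinner_zero_commute[of "S x" "S y"] by (simp add: w_def)
  \<comment> \<open>Chosen for the step t = w / M: the second-order loss is (M - 1) |w|^2 / M^2,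
    which stays below the first-order gain 2 |w|^2 / M. The summand 1 keeps M positive.\<close>
  define M where "M = (norm (S x) * norm y)\<^sup>2 + 1"
  have M: "M > 0" by (simp add: M_def add_nonneg_pos)
  define t where "t = complex_of_real (1 / M) * w"
  have ct: "cmod t = cmod w / M" using M by (simp add: t_def norm_mult norm_divide)
  have re: "Re (cnj t * w) = (cmod w)\<^sup>2 / M"
  proof -
    have "cnj t * w = complex_of_real (1 / M) * (w * cnj w)" by (simp add: t_def)
    also have "\<dots> = complex_of_real ((cmod w)\<^sup>2 / M)"
      by (simp only: complex_norm_square[symmetric] of_real_mult[symmetric]) simp
    finally show ?thesis by (metis Re_complex_of_real)
  qed
  have "(norm (S x))\<^sup>2 + 2 * Re (cnj t * w) \<le> (norm (S x + t *\<^sub>C S y))\<^sup>2"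
    unfolding norm_add_sq by (simp add: cinner_scaleC_right w_def)
  also have "\<dots> = (norm (S (x + t *\<^sub>C y)))\<^sup>2" using S by (simp add: clinear_def)
  also have "\<dots> \<le> (norm (S x) * norm (x + t *\<^sub>C y))\<^sup>2" by (intro power_mono max) auto
  also have "\<dots> = (norm (S x))\<^sup>2 * (1 + (cmod t * norm y)\<^sup>2)"
    using xy assms(2) cinner_zero_commute[of x y]
    by (simp add: power_mult_distrib norm_add_sq cinner_scaleC_right norm_scaleC)
  finally have "2 * ((cmod w)\<^sup>2 / M) \<le> (norm (S x))\<^sup>2 * (cmod w / M * norm y)\<^sup>2"
    unfolding re ct by (simp add: distrib_left)
  also have "\<dots> = (M - 1) * (cmod w / M)\<^sup>2" by (simp add: M_def power_mult_distrib power_divide)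
  also have "\<dots> \<le> M * (cmod w / M)\<^sup>2" by (intro mult_right_mono) auto
  also have "\<dots> = (cmod w)\<^sup>2 / M" using M by (simp add: power2_eq_square)
  finally have "(cmod w)\<^sup>2 / M \<le> 0" by simp
  moreover have "(cmod w)\<^sup>2 / M > 0" using w M by simp
  ultimately show False by linarith
qed

text \<open>Finite rank is covered by padding: a zero singular value comes with zero vectors on both
  sides, so \<open>u\<close> lists no unit vectors of the kernel. The last clause fixes S on the
  orthogonal complement of \<open>u\<close>, which makes the data determine a bounded linear
  S.\<close>

definition svd :: "('a::complex_inner \<Rightarrow> 'a) \<Rightarrow> (nat \<Rightarrow> real) \<Rightarrow> (nat \<Rightarrow> 'a) \<Rightarrow> (nat \<Rightarrow> 'a) \<Rightarrow> bool" where
  "svd S s u v \<longleftrightarrow> on_seq u \<and> on_seq v \<and> antimono s \<and> (\<forall>n. 0 \<le> s n) \<and> s \<longlonglongrightarrow> 0 \<and>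
     (\<forall>n. S (u n) = complex_of_real (s n) *\<^sub>C v n) \<and>
     (\<forall>n. s n = 0 \<longleftrightarrow> u n = 0) \<and> (\<forall>n. s n = 0 \<longleftrightarrow> v n = 0) \<and>
     (\<forall>x. (\<forall>n. cinner x (u n) = 0) \<longrightarrow> S x = 0)"

theorem compact_op_svd:
  fixes S :: "'a::chilbert_space \<Rightarrow> 'a"
  assumes S: "compact_op S"
  obtains s u v where "svd S s u v"
proof -
  have cl: "clinear S" using S by (simp add: compact_op_def bounded_clinear_def)
  have "bounded_linear S" using S by (simp add: compact_op_def bounded_clinear_imp_bounded_linear)
  then interpret S: bounded_linear S .
  define W where "W u n = {x::'a. \<forall>i<n. cinner x (u i) = 0}" for u and n :: nat
  \<comment> \<open>The value 0 is possible only when S vanishes on all of \<open>W u n\<close>,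
    since the maximality clause for r = 0 says exactly this. It serves as the padding once the rank
    is exhausted.\<close>
  define P where "P u n r \<longleftrightarrow> r \<in> W u n \<and> (\<forall>x\<in>W u n. norm (S x) \<le> norm (S r) * norm x) \<and>
    (r = 0 \<or> norm r = 1 \<and> S r \<noteq> 0)" for u n r
  have "\<exists>u. \<forall>n. P u n (u n)"
  proof (rule dependent_wellorder_choice)
    fix r :: 'a and f g :: "nat \<Rightarrow> 'a" and n :: nat
    assume "\<And>y. y < n \<Longrightarrow> f y = g y"
    then have "W f n = W g n" by (simp add: W_def)
    then show "P f n r = P g n r" by (simp add: P_def)
  next
    fix n :: nat and u :: "nat \<Rightarrow> 'a"
    show "\<exists>r. P u n r"
    proof (cases "\<exists>w\<in>W u n. S w \<noteq> 0")
      case False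
      then show ?thesis by (intro exI[of _ 0]) (auto simp: P_def W_def)
    next
      case True
      then obtain w where w: "w \<in> W u n" "S w \<noteq> 0" by blast
      have "W u n = (\<Inter>i\<in>{..<n}. {x. cinner x (u i) = 0})" by (auto simp: W_def)
      also have "closed \<dots>"
        by (intro closed_INT ballI closed_Collect_eq linear_continuous_on
            cinner.bounded_linear_left continuous_on_const)
      finally have cW: "closed (W u n)" .
      obtain x where "x \<in> W u n" "norm x = 1" "S x \<noteq> 0"
        "\<And>y. y \<in> W u n \<Longrightarrow> norm (S y) \<le> norm (S x) * norm y"
        by (rule compact_op_attains_norm[OF S cW _ _ w])
          (auto simp: W_def cinner_add_left cinner.scaleR_left)
      then show ?thesis by (intro exI[of _ x]) (auto simp: P_def)
    qed
  qed
  then obtain u where u: "\<And>n. P u n (u n)" by blast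
  define s where "s n = norm (S (u n))" for n
  define v where "v n = (1 / s n) *\<^sub>R S (u n)" for n
  have uW: "u n \<in> W u n" and umax: "x \<in> W u n \<Longrightarrow> norm (S x) \<le> s n * norm x"
    and u01: "u n = 0 \<or> norm (u n) = 1 \<and> S (u n) \<noteq> 0" for n x
    using u[of n] by (auto simp: P_def s_def)
  have anti: "cinner (u m) (u n) = 0" if "n < m" for m n using uW[of m] that by (simp add: W_def)
  have on_u: "on_seq u"
    unfolding on_seq_def using anti u01 by (metis cinner_zero_commute linorder_neqE_nat)
  have Wmono: "W u m \<subseteq> W u n" if "n \<le> m" for m n using that by (auto simp: W_def)
  have s_anti: "antimono s"
  proof (rule antimonoI)
    fix n m :: nat assume "n \<le> m"
    then have "norm (S (u m)) \<le> s n * norm (u m)" using uW Wmono umax by blast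
    also have "\<dots> \<le> s n * 1" using u01[of m] by (intro mult_left_mono) (auto simp: s_def)
    finally show "s m \<le> s n" by (simp add: s_def)
  qed
  have s0: "s n = 0 \<longleftrightarrow> u n = 0" for n using u01[of n] by (auto simp: s_def)
  \<comment> \<open>For n < m the vector u m lies in the complement on which u n is maximal, so the
    perturbation of u n along u m is admissible.\<close>
  have So: "cinner (S (u m)) (S (u n)) = 0" if "n < m" for m n
  proof (cases "u n = 0")
    case False
    show ?thesis
    proof (rule maximizer_orthogonal[OF cl _ anti[OF that]])
      show "norm (u n) = 1" using False u01 by blast
      fix t
      have "u m \<in> W u n" using uW Wmono that by (meson less_imp_le subsetD)
      then have "u n + t *\<^sub>C u m \<in> W u n" using uW[of n]
        by (auto simp: W_def cinner_add_left cinner_scaleC_left)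
      then show "norm (S (u n + t *\<^sub>C u m)) \<le> norm (S (u n)) * norm (u n + t *\<^sub>C u m)"
        using umax by (simp add: s_def)
    qed
  qed simp
  then have So': "cinner (S (u m)) (S (u n)) = 0" if "n \<noteq> m" for m n
    using that by (metis cinner_zero_commute linorder_neqE_nat)
  have on_v: "on_seq v"
    unfolding on_seq_def
  proof (intro conjI allI impI)
    fix i j :: nat assume "i \<noteq> j"
    then show "cinner (v i) (v j) = 0"
      by (simp add: v_def cinner.scaleR_left cinner.scaleR_right So')
  next
    fix i show "v i = 0 \<or> norm (v i) = 1" by (auto simp: v_def s_def)
  qed
  have v0: "s n = 0 \<longleftrightarrow> v n = 0" for n by (auto simp: v_def s_def)
  have Sv: "S (u n) = complex_of_real (s n) *\<^sub>C v n" for n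
    by (cases "s n = 0") (auto simp: v_def s_def scaleR_scaleC[symmetric])
  \<comment> \<open>If the singular values stayed above some L > 0, the images S (u n) would be
    pairwise orthogonal of norm at least L, hence at mutual distance at least L, and no subsequence
    could converge.\<close>
  have s_lim: "s \<longlonglongrightarrow> 0"
  proof -
    have "bdd_below (range s)" by (auto simp: bdd_below_def s_def intro!: exI[of _ 0])
    then have lim: "s \<longlonglongrightarrow> (INF n. s n)" using s_anti by (rule LIMSEQ_decseq_INF)
    define L where "L = (INF n. s n)"
    have L: "L \<le> s n" for n using decseq_ge[OF s_anti lim] by (simp add: L_def)
    have "L \<ge> 0" using lim LIMSEQ_le_const[of s L 0] by (auto simp: s_def L_def)
    moreover have "\<not> L > 0"
    proof
      assume pos: "L > 0"
      obtain y r where r: "strict_mono r" "(\<lambda>n. S (u (r n))) \<longlonglongrightarrow> y"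
        using compact_op_convergent_subseq[where S = S and x = u, OF S] on_seq_norm_le[OF on_u] by metis
      have "Cauchy (\<lambda>n. S (u (r n)))" using r(2) LIMSEQ_imp_Cauchy by blast
      then obtain N where N: "\<And>m n. m \<ge> N \<Longrightarrow> n \<ge> N \<Longrightarrow> norm (S (u (r m)) - S (u (r n))) < L"
        using pos unfolding Cauchy_iff by blast
      have ne: "r N \<noteq> r (Suc N)" using strict_monoD[OF r(1), of N "Suc N"] by simp
      have nd: "(norm (S (u (r N)) + - S (u (r (Suc N)))))\<^sup>2 = (s (r N))\<^sup>2 + (s (r (Suc N)))\<^sup>2"
        by (subst norm_add_orthogonal) (use So'[OF ne[symmetric]] in \<open>simp_all add: cinner.minus_right s_def\<close>)
      have "L\<^sup>2 \<le> (s (r N))\<^sup>2" using L pos by (intro power_mono) auto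
      then have "L\<^sup>2 \<le> (norm (S (u (r N)) + - S (u (r (Suc N)))))\<^sup>2"
        unfolding nd using zero_le_power2[of "s (r (Suc N))"] by linarith
      then have "L\<^sup>2 \<le> (norm (S (u (r N)) - S (u (r (Suc N)))))\<^sup>2" by simp
      then have "L \<le> norm (S (u (r N)) - S (u (r (Suc N))))" by (rule power2_le_imp_le) simp
      with N[of N "Suc N"] show False by simp
    qed
    ultimately have "L = 0" by linarith
    with lim show ?thesis by (simp add: L_def)
  qed
  have ker: "S x = 0" if "\<forall>n. cinner x (u n) = 0" for x
  proof -
    have "norm (S x) \<le> s n * norm x" for n using that by (intro umax) (simp add: W_def)
    moreover have "(\<lambda>n. s n * norm x) \<longlonglongrightarrow> 0 * norm x" by (intro tendsto_intros s_lim)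
    ultimately have "norm (S x) \<le> 0 * norm x" by (intro LIMSEQ_le_const) auto
    then show ?thesis by simp
  qed
  show ?thesis
    by (rule that[of s u v], unfold svd_def)
      (use on_u on_v s_anti s_lim Sv s0 v0 ker in \<open>auto simp: s_def\<close>)
qed

lemma svd_eq_0_iff: "svd S s u v \<Longrightarrow> s n = 0 \<longleftrightarrow> u n = 0"
  unfolding svd_def by blast

lemma svd_bound: "svd S s u v \<Longrightarrow> \<forall>n. \<bar>s n\<bar> \<le> s 0"
  by (auto simp: svd_def antimono_def)

text \<open>The decomposition determines the operator. The uniqueness of the absolute value is later
  derived from this, by showing that any candidate has the same data.\<close>

lemma svd_eq_diag_op:
  fixes S :: "'a::chilbert_space \<Rightarrow> 'a"
  assumes S: "bounded_clinear S" and svd: "svd S s u v"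
  shows "S = diag_op s u v"
proof
  fix x
  interpret S: bounded_linear S by (rule bounded_clinear_imp_bounded_linear[OF S])
  have on: "on_seq u" "on_seq v" using svd by (auto simp: svd_def)
  obtain y z where x: "x = y + z" "(\<lambda>n. cinner x (u n) *\<^sub>C u n) sums y" "\<And>n. cinner z (u n) = 0"
    using on_seq_decompose[OF on(1)] by metis
  have "S z = 0" using x(3) svd by (simp add: svd_def)
  then have Sx: "S x = S y" by (simp add: x(1) S.add)
  have "(\<lambda>n. S (cinner x (u n) *\<^sub>C u n)) sums S y" by (rule S.sums[OF x(2)])
  moreover have "S (cinner x (u n) *\<^sub>C u n) = (complex_of_real (s n) * cinner x (u n)) *\<^sub>C v n" for n
    using svd by (simp add: svd_def bounded_clinear_scaleC[OF S] scaleC_scaleC mult.commute)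
  ultimately show "S x = diag_op s u v x"
    using diag_op_sums[OF on svd_bound[OF svd], of x] Sx by (metis (no_types, lifting) sums_cong sums_unique2)
qed

text \<open>Here the factor <v n, v n> disappears, because a padding vector v n comes with s n =
  0.\<close>

lemma cinner_svd_right:
  fixes S :: "'a::chilbert_space \<Rightarrow> 'a"
  assumes S: "bounded_clinear S" and svd: "svd S s u v"
  shows "cinner (S x) (v n) = complex_of_real (s n) * cinner x (u n)"
proof -
  have on: "on_seq u" "on_seq v" using svd by (auto simp: svd_def)
  have "cinner (diag_op s u v x) (v n) = complex_of_real (s n) * cinner x (u n) * cinner (v n) (v n)"
    by (rule cinner_diag_op_right[OF on svd_bound[OF svd]])
  moreover have "v n = 0 \<Longrightarrow> s n = 0" using svd unfolding svd_def by blast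
  ultimately show ?thesis
    unfolding svd_eq_diag_op[OF S svd, symmetric] on_seq_cinner_self[OF on(2)] by auto
qed

section \<open>Spans of orthonormal sets\<close>

lemma cspan_finite:
  fixes B :: "'a::complex_normed_vector set"
  assumes "finite B"
  shows "cspan B = {\<Sum>e\<in>B. c e *\<^sub>C e | c. True}"
proof -
  have "\<exists>d. (\<Sum>e\<in>F. c e *\<^sub>C e) = (\<Sum>e\<in>B. d e *\<^sub>C e)" if "F \<subseteq> B" for F and c :: "'a \<Rightarrow> complex"
    by (rule exI[of _ "\<lambda>e. if e \<in> F then c e else 0"])
      (use that assms in \<open>auto intro!: sum.mono_neutral_cong_left\<close>)
  then show ?thesis using assms unfolding cspan_def by blast
qed

lemma cspan_add:
  fixes B :: "'a::complex_normed_vector set"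
  assumes "x \<in> cspan B" "y \<in> cspan B"
  shows "x + y \<in> cspan B"
proof -
  obtain F c G d where F: "finite F" "F \<subseteq> B" "x = (\<Sum>e\<in>F. c e *\<^sub>C e)"
    and G: "finite G" "G \<subseteq> B" "y = (\<Sum>e\<in>G. d e *\<^sub>C e)"
    using assms unfolding cspan_def by blast
  have "x \<in> cspan (F \<union> G)" "y \<in> cspan (F \<union> G)" using F G unfolding cspan_def by blast+
  then obtain a b where "x = (\<Sum>e\<in>F \<union> G. a e *\<^sub>C e)" "y = (\<Sum>e\<in>F \<union> G. b e *\<^sub>C e)"
    using cspan_finite[of "F \<union> G"] F G by auto
  then have "x + y = (\<Sum>e\<in>F \<union> G. (a e + b e) *\<^sub>C e)" by (simp add: sum.distrib scaleC_add_left)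
  then show ?thesis using F G unfolding cspan_def
    by (intro CollectI exI[of _ "F \<union> G"] exI[of _ "\<lambda>e. a e + b e"]) auto
qed

lemma cspan_scaleC:
  fixes B :: "'a::complex_normed_vector set"
  assumes "x \<in> cspan B"
  shows "c *\<^sub>C x \<in> cspan B"
proof -
  obtain F d where F: "finite F" "F \<subseteq> B" "x = (\<Sum>e\<in>F. d e *\<^sub>C e)"
    using assms unfolding cspan_def by blast
  then have "c *\<^sub>C x = (\<Sum>e\<in>F. (c * d e) *\<^sub>C e)" by (simp add: scaleC.sum_right scaleC_scaleC)
  then show ?thesis using F(1,2) unfolding cspan_def
    by (intro CollectI exI[of _ F] exI[of _ "\<lambda>e. c * d e"]) auto
qed

lemma cspan_zero: "0 \<in> cspan B"
  unfolding cspan_def by (intro CollectI exI[of _ "{}"]) auto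

lemma cspan_base: "x \<in> B \<Longrightarrow> x \<in> cspan B" for B :: "'a::complex_normed_vector set"
  unfolding cspan_def by (intro CollectI exI[of _ "{x}"] exI[of _ "\<lambda>_. 1"]) auto

lemma cspan_sum: "(\<And>i. i \<in> I \<Longrightarrow> f i \<in> cspan B) \<Longrightarrow> (\<Sum>i\<in>I. f i) \<in> cspan B"
  for B :: "'a::complex_normed_vector set"
  by (induction I rule: infinite_finite_induct) (auto intro: cspan_zero cspan_add)

lemma cspan_mono: "B \<subseteq> C \<Longrightarrow> cspan B \<subseteq> cspan C"
  unfolding cspan_def by blast

section \<open>Projections onto finite-dimensional spans\<close>

definition proj_onto :: "'a::complex_inner set \<Rightarrow> 'a \<Rightarrow> 'a" where
  "proj_onto G x = (\<Sum>g\<in>G. cinner x g *\<^sub>C g)"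

lemma proj_onto_in_cspan: "proj_onto G x \<in> cspan G"
  unfolding proj_onto_def by (intro cspan_sum cspan_scaleC cspan_base)

lemma cinner_sum_orthonormal:
  assumes "finite G" "orthonormal G" "g \<in> G"
  shows "cinner (\<Sum>h\<in>G. c h *\<^sub>C h) g = c g"
proof -
  have "cinner (\<Sum>h\<in>G. c h *\<^sub>C h) g = (\<Sum>h\<in>G. c h * cinner h g)"
    by (simp add: cinner.sum_left cinner_scaleC_left)
  also have "\<dots> = (\<Sum>h\<in>G. if h = g then c g else 0)"
    using assms by (intro sum.cong) (auto simp: orthonormal_def)
  finally show ?thesis using assms by simp
qed

lemma proj_onto_cspan:
  assumes "finite G" "orthonormal G" "x \<in> cspan G"
  shows "proj_onto G x = x"
proof -
  obtain c where x: "x = (\<Sum>h\<in>G. c h *\<^sub>C h)" using assms cspan_finite by blast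
  show ?thesis unfolding proj_onto_def x by (simp add: cinner_sum_orthonormal[OF assms(1,2)])
qed

lemma cinner_proj_onto:
  assumes "finite G" "orthonormal G" "g \<in> G"
  shows "cinner (proj_onto G x) g = cinner x g"
  unfolding proj_onto_def by (rule cinner_sum_orthonormal[OF assms])

lemma cinner_cspan_zero:
  assumes "\<And>g. g \<in> G \<Longrightarrow> cinner x g = 0" "y \<in> cspan G"
  shows "cinner x y = 0"
proof -
  obtain F c where "F \<subseteq> G" "y = (\<Sum>e\<in>F. c e *\<^sub>C e)" using assms(2) unfolding cspan_def by blast
  then show ?thesis using assms(1)
    by (auto simp: cinner.sum_right cinner_scaleC_right subset_iff intro!: sum.neutral)
qed

lemma cinner_proj_onto_left: "cinner (proj_onto G x) y = (\<Sum>g\<in>G. cinner x g * cinner g y)"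
  by (simp add: proj_onto_def cinner.sum_left cinner_scaleC_left)

lemma cinner_proj_onto_right: "cinner x (proj_onto G y) = (\<Sum>g\<in>G. cinner x g * cinner g y)"
  unfolding proj_onto_def cinner.sum_right cinner_scaleC_right
  by (intro sum.cong refl) (metis cinner_commute mult.commute)

lemma cinner_proj_onto_cspan:
  assumes "finite G" "orthonormal G" "y \<in> cspan G"
  shows "cinner (proj_onto G x) y = cinner x y"
  unfolding cinner_proj_onto_left cinner_proj_onto_right[symmetric] proj_onto_cspan[OF assms] ..

lemma norm_proj_onto_decompose:
  assumes "finite G" "orthonormal G"
  shows "(norm x)\<^sup>2 = (norm (proj_onto G x))\<^sup>2 + (norm (x - proj_onto G x))\<^sup>2"
proof -
  have "cinner (x - proj_onto G x) (proj_onto G x) = 0"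
    by (simp add: cinner.diff_left cinner_proj_onto_cspan[OF assms proj_onto_in_cspan])
  then have "cinner (proj_onto G x) (x - proj_onto G x) = 0" by (metis cinner_zero_commute)
  from norm_add_orthogonal[OF this] show ?thesis by simp
qed

lemma norm_proj_onto_le:
  assumes "finite G" "orthonormal G"
  shows "norm (proj_onto G x) \<le> norm x" "norm (x - proj_onto G x) \<le> norm x"
  by (rule power2_le_imp_le, use norm_proj_onto_decompose[OF assms, of x] in simp, simp)+

lemma orthonormal_parseval:
  assumes "finite G" "orthonormal G" "x \<in> cspan G"
  shows "(\<Sum>g\<in>G. (cmod (cinner x g))\<^sup>2) = (norm x)\<^sup>2"
proof -
  have "complex_of_real ((norm x)\<^sup>2) = cinner (proj_onto G x) x"
    using proj_onto_cspan[OF assms] by (simp add: cinner_self)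
  also have "\<dots> = complex_of_real (\<Sum>g\<in>G. (cmod (cinner x g))\<^sup>2)"
    unfolding cinner_proj_onto_left of_real_sum complex_norm_square
    by (intro sum.cong refl) (metis cinner_commute)
  finally show ?thesis by (metis of_real_eq_iff)
qed

text \<open>Double counting of the sum of |<b, c>|^2 over all pairs: by Parseval each row and each
  column contributes 1. This makes multiplicities of singular values independent of the chosen
  eigenbasis.\<close>

lemma card_orthonormal_cspan_eq:
  assumes "finite B" "orthonormal B" "finite C" "orthonormal C" "cspan B = cspan C"
  shows "card B = card C"
proof -
  have *: "real (card B) = (\<Sum>b\<in>B. \<Sum>c\<in>C. (cmod (cinner b c))\<^sup>2)"
    if "finite C" "orthonormal C" "cspan B \<subseteq> cspan C" "orthonormal B" for B C :: "'a set"
  proof -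
    have "(\<Sum>c\<in>C. (cmod (cinner b c))\<^sup>2) = 1" if "b \<in> B" for b
    proof -
      have "cinner b b = 1" using \<open>orthonormal B\<close> that by (simp add: orthonormal_def)
      then have "complex_of_real ((norm b)\<^sup>2) = complex_of_real 1" by (simp add: cinner_self)
      then have "(norm b)\<^sup>2 = 1" by (simp only: of_real_eq_iff)
      moreover have "b \<in> cspan C" using cspan_base[OF that] \<open>cspan B \<subseteq> cspan C\<close> by blast
      ultimately show ?thesis
        using orthonormal_parseval[OF \<open>finite C\<close> \<open>orthonormal C\<close>] by simp
    qed
    then show ?thesis by simp
  qed
  have "real (card B) = (\<Sum>b\<in>B. \<Sum>c\<in>C. (cmod (cinner b c))\<^sup>2)" using assms by (intro *) auto
  also have "\<dots> = (\<Sum>c\<in>C. \<Sum>b\<in>B. (cmod (cinner c b))\<^sup>2)"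
    by (subst sum.swap) (simp add: norm_cinner_commute)
  also have "\<dots> = real (card C)" using assms by (intro *[symmetric]) auto
  finally show ?thesis by simp
qed

section \<open>Absolute value and singular values of a compact operator\<close>

lemma adjoint_eqI:
  assumes "\<And>x y. cinner (T x) y = cinner x (T' y)"
  shows "adjoint T = T'"
  unfolding adjoint_def
proof (rule the_equality)
  fix T'' assume "\<forall>x y. cinner (T x) y = cinner x (T'' y)"
  then have "cinner (T'' y) x = cinner (T' y) x" for x y by (metis assms cinner_commute)
  then show "T'' = T'" by (intro ext cinner_eqI)
qed (use assms in blast)

lemma adjoint_diag_op:
  fixes u :: "nat \<Rightarrow> 'a::chilbert_space"
  assumes "on_seq u" "on_seq v" "\<forall>n. \<bar>s n\<bar> \<le> M"
  shows "adjoint (diag_op s u v) = diag_op s v u"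
proof (rule adjoint_eqI)
  fix x y
  have "(\<lambda>n. complex_of_real (s n) * cinner y (v n) * cinner (u n) x) sums cinner (diag_op s v u y) x"
    by (rule cinner_diag_op_sums[OF assms(2,1,3)])
  then have "(\<lambda>n. cnj (complex_of_real (s n) * cinner y (v n) * cinner (u n) x)) sums
      cnj (cinner (diag_op s v u y) x)" by (simp only: sums_cnj)
  also have "cnj (cinner (diag_op s v u y) x) = cinner x (diag_op s v u y)" by (metis cinner_commute)
  also have "(\<lambda>n. cnj (complex_of_real (s n) * cinner y (v n) * cinner (u n) x)) =
      (\<lambda>n. complex_of_real (s n) * cinner x (u n) * cinner (v n) y)"
    by (simp add: cinner_commute[symmetric] mult_ac)
  finally show "cinner (diag_op s u v x) y = cinner x (diag_op s v u y)"
    using cinner_diag_op_sums[OF assms] sums_unique2 by blast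
qed

text \<open>Polarization: realness of the quadratic form at x + y relates the imaginary parts of <R
  x, y> and <R y, x>, and realness at x + i y relates their real parts.\<close>

lemma positive_op_symmetric:
  assumes "positive_op R"
  shows "cinner (R x) y = cinner x (R y)"
proof -
  have R: "clinear R" using assms by (simp add: positive_op_def bounded_clinear_def)
  have im: "Im (cinner (R z) z) = 0" for z using assms by (simp add: positive_op_def)
  have e1: "cinner (R (x + y)) (x + y) = cinner (R x) x + cinner (R x) y + cinner (R y) x + cinner (R y) y"
    using R by (simp add: clinear_def cinner_add_left cinner_add_right)
  have e2: "cinner (R (x + \<i> *\<^sub>C y)) (x + \<i> *\<^sub>C y)
      = cinner (R x) x - \<i> * cinner (R x) y + \<i> * cinner (R y) x + cinner (R y) y"
    using R by (simp add: clinear_def cinner_add_left cinner_add_right cinner_scaleC_left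
        cinner_scaleC_right algebra_simps)
  have "Im (cinner (R x) y) + Im (cinner (R y) x) = 0"
    using arg_cong[OF e1, of Im] im by simp
  moreover have "Re (cinner (R y) x) - Re (cinner (R x) y) = 0"
    using arg_cong[OF e2, of Im] im by simp
  ultimately have "cinner (R x) y = cnj (cinner (R y) x)" by (simp add: complex_eq_iff)
  then show ?thesis by (metis cinner_commute)
qed

text \<open>Since R^2 - \<mu>^2 = (R + \<mu>) (R - \<mu>), the vector R x - \<mu> x is sent by R to
  its multiple by -\<mu>. Positivity of R then forces this vector to be zero.\<close>

lemma positive_op_eigen_of_square:
  assumes R: "positive_op R" and \<mu>: "\<mu> > 0" and sq: "R (R x) = complex_of_real (\<mu>\<^sup>2) *\<^sub>C x"
  shows "R x = complex_of_real \<mu> *\<^sub>C x"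
proof -
  have bc: "bounded_clinear R" using R by (simp add: positive_op_def)
  interpret R: bounded_linear R by (rule bounded_clinear_imp_bounded_linear[OF bc])
  define w where "w = R x - complex_of_real \<mu> *\<^sub>C x"
  have "R w = - (complex_of_real \<mu> *\<^sub>C w)"
    by (simp add: w_def R.diff bounded_clinear_scaleC[OF bc] sq scaleC.diff_right scaleC_scaleC power2_eq_square)
  then have "cinner (R w) w = - complex_of_real (\<mu> * (norm w)\<^sup>2)"
    by (simp add: cinner.minus_left cinner_scaleC_left cinner_self)
  moreover have "0 \<le> Re (cinner (R w) w)" using R by (simp add: positive_op_def)
  ultimately have "\<mu> * (norm w)\<^sup>2 \<le> 0" by simp
  with \<mu> have "w = 0" by (simp add: mult_le_0_iff)
  then show ?thesis by (simp add: w_def)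
qed

lemma svd_diag_op:
  fixes u :: "nat \<Rightarrow> 'a::chilbert_space"
  assumes "svd S s u v"
  shows "svd (diag_op s u u) s u u"
proof -
  have on: "on_seq u" using assms by (simp add: svd_def)
  have "diag_op s u u (u n) = complex_of_real (s n) *\<^sub>C u n" for n
  proof -
    have "(\<lambda>k. (complex_of_real (s k) * cinner (u n) (u k)) *\<^sub>C u k) sums
      (\<Sum>k\<in>{n}. (complex_of_real (s k) * cinner (u n) (u k)) *\<^sub>C u k)"
      by (rule sums_finite) (use on in \<open>auto simp: on_seq_def\<close>)
    with diag_op_sums[OF on on svd_bound[OF assms], of "u n"]
    have "diag_op s u u (u n) = (complex_of_real (s n) * cinner (u n) (u n)) *\<^sub>C u n"
      using sums_unique2 by fastforce
    then show ?thesis using on_seq_scaleC_cinner_self[OF on, of n] by (metis scaleC_scaleC)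
  qed
  then show ?thesis using assms by (auto simp: svd_def diag_op_def)
qed

lemma positive_op_diag_op:
  fixes u :: "nat \<Rightarrow> 'a::chilbert_space"
  assumes "on_seq u" "\<forall>n. \<bar>s n\<bar> \<le> M" "\<forall>n. 0 \<le> s n"
  shows "positive_op (diag_op s u u)"
  unfolding positive_op_def
proof (intro conjI allI)
  show "bounded_clinear (diag_op s u u)" by (rule bounded_clinear_diag_op[OF assms(1,1,2)])
  fix x
  have sums: "(\<lambda>n. complex_of_real (s n * (cmod (cinner x (u n)))\<^sup>2)) sums cinner (diag_op s u u x) x"
  proof -
    have "complex_of_real (s n) * cinner x (u n) * cinner (u n) x
        = complex_of_real (s n * (cmod (cinner x (u n)))\<^sup>2)" for n
      by (simp only: of_real_mult complex_norm_square mult.assoc cinner_commute[of "u n" x])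
    then show ?thesis using cinner_diag_op_sums[OF assms(1,1,2), of x x] by (simp only:)
  qed
  have "(\<lambda>n. 0) sums Im (cinner (diag_op s u u x) x)"
    using sums_Im[OF sums] by (simp only: Im_complex_of_real)
  then show "Im (cinner (diag_op s u u x) x) = 0" using sums_unique2 sums_zero by blast
  have "(\<lambda>n. s n * (cmod (cinner x (u n)))\<^sup>2) sums Re (cinner (diag_op s u u x) x)"
    using sums_Re[OF sums] by (simp only: Re_complex_of_real)
  from sums_le[OF _ sums_zero this] show "0 \<le> Re (cinner (diag_op s u u x) x)"
    using assms(3) by simp
qed

text \<open>The definite description calls for uniqueness of the positive square root. A competitor
  R' has the same square, so it has the eigenvalue s n at each nonzero u n; on the complement of
  \<open>u\<close> symmetry gives <R' x, R' x> = <x, R' (R' x)> = 0. It therefore has the same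
  decomposition as \<open>diag_op s u u\<close>.\<close>

lemma abs_op_svd:
  fixes S :: "'a::chilbert_space \<Rightarrow> 'a"
  assumes S: "bounded_clinear S" and svd: "svd S s u v"
  shows "abs_op S = diag_op s u u"
  unfolding abs_op_def
proof (rule the_equality)
  have on: "on_seq u" "on_seq v" and s0: "\<forall>n. 0 \<le> s n" using svd by (auto simp: svd_def)
  note b = svd_bound[OF svd]
  let ?R = "diag_op s u u"
  have posR: "positive_op ?R" by (rule positive_op_diag_op[OF on(1) b s0])
  have svdR: "svd ?R s u u" by (rule svd_diag_op[OF svd])
  have bR: "bounded_clinear ?R" using posR by (simp add: positive_op_def)
  have adj: "adjoint S = diag_op s v u"
    using adjoint_diag_op[OF on b] svd_eq_diag_op[OF S svd] by simp
  have sq: "?R \<circ> ?R = adjoint S \<circ> S"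
  proof
    fix x
    show "(?R \<circ> ?R) x = (adjoint S \<circ> S) x"
      unfolding adj o_def diag_op_def[of s u u "?R x"] diag_op_def[of s v u "S x"]
        cinner_svd_right[OF S svd] cinner_svd_right[OF bR svdR] ..
  qed
  show "positive_op ?R \<and> ?R \<circ> ?R = adjoint S \<circ> S" using posR sq by blast
  fix R' assume R': "positive_op R' \<and> R' \<circ> R' = adjoint S \<circ> S"
  then have bR': "bounded_clinear R'" by (simp add: positive_op_def)
  have eq: "R' (R' x) = ?R (?R x)" for x using R' sq by (metis comp_apply)
  have "R' (u n) = complex_of_real (s n) *\<^sub>C u n" for n
  proof (cases "s n = 0")
    case True
    then have "u n = 0" by (simp add: svd_eq_0_iff[OF svd])
    then show ?thesis using bounded_clinear_scaleC[OF bR', of 0 "0"] by simp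
  next
    case False
    then have "s n > 0" using s0 by (simp add: less_le)
    moreover have "R' (R' (u n)) = complex_of_real ((s n)\<^sup>2) *\<^sub>C u n"
      using svdR by (simp add: eq svd_def bounded_clinear_scaleC[OF bR] scaleC_scaleC power2_eq_square)
    ultimately show ?thesis using R' positive_op_eigen_of_square by blast
  qed
  moreover have "R' x = 0" if "\<forall>n. cinner x (u n) = 0" for x
  proof -
    have "?R x = 0" using svdR that by (simp add: svd_def)
    then have "R' (R' x) = 0" using bounded_clinear_scaleC[OF bR, of 0 "0"] by (simp add: eq)
    then have "cinner (R' x) (R' x) = 0" using R' positive_op_symmetric[of R' x "R' x"] by simp
    then show ?thesis by (simp add: cinner_eq_zero_iff)
  qed
  ultimately have "svd R' s u u" using svdR by (auto simp: svd_def)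
  then show "R' = ?R" by (rule svd_eq_diag_op[OF bR'])
qed

text \<open>The u n with s n = \<mu> span the eigenspace: an eigenvector x satisfies \<mu> <x, u n>
  = s n <x, u n>, so its other coefficients vanish and the series for R x, which is \<mu> x, is a
  finite sum over these n. They are finitely many because s tends to 0.\<close>

lemma svd_singular_value_seq:
  fixes S :: "'a::chilbert_space \<Rightarrow> 'a"
  assumes S: "bounded_clinear S" and svd: "svd S s u v"
  shows "singular_value_seq S s"
  unfolding singular_value_seq_def
proof (intro conjI allI impI)
  show "antimono s" using svd by (simp add: svd_def)
  show "0 \<le> s n" for n using svd by (simp add: svd_def)
  fix \<mu> :: real assume \<mu>: "0 < \<mu>"
  let ?J = "{n. s n = \<mu>}" and ?R = "diag_op s u u"
  have on: "on_seq u" using svd by (simp add: svd_def)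
  have svdR: "svd ?R s u u" by (rule svd_diag_op[OF svd])
  have posR: "positive_op ?R"
    using svd by (intro positive_op_diag_op[OF on svd_bound[OF svd]]) (simp add: svd_def)
  have bR: "bounded_clinear ?R" using posR by (simp add: positive_op_def)
  then interpret R: bounded_linear ?R by (rule bounded_clinear_imp_bounded_linear)
  have "s \<longlonglongrightarrow> 0" using svd by (simp add: svd_def)
  then obtain N where N: "\<And>n. n \<ge> N \<Longrightarrow> \<bar>s n\<bar> < \<mu>" using \<mu> unfolding LIMSEQ_iff by auto
  then have "?J \<subseteq> {..<N}" using \<mu> by (metis (mono_tags, lifting) abs_of_pos lessThan_iff
        less_irrefl mem_Collect_eq not_less subsetI)
  then show fin: "finite ?J" using finite_subset by blast
  have u1: "u n \<noteq> 0" if "n \<in> ?J" for n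
    using that \<mu> svd_eq_0_iff[OF svd, of n] by auto
  have inj: "inj_on u ?J"
  proof (rule inj_onI)
    fix i j assume "i \<in> ?J" "j \<in> ?J" "u i = u j"
    then have "cinner (u i) (u j) = 1" using u1 on_seq_cinner_self[OF on, of i] by simp
    then show "i = j" using on_seq_cinner[OF on, of i j] by (metis zero_neq_one)
  qed
  show "\<exists>B. finite B \<and> orthonormal B \<and> card B = card ?J \<and>
      cspan B = {x. abs_op S x = complex_of_real \<mu> *\<^sub>C x}"
  proof (intro exI[of _ "u ` ?J"] conjI)
    show "finite (u ` ?J)" using fin by simp
    show "orthonormal (u ` ?J)" using u1 by (auto simp: orthonormal_def on_seq_cinner[OF on])
    show "card (u ` ?J) = card ?J" by (rule card_image[OF inj])
    show "cspan (u ` ?J) = {x. abs_op S x = complex_of_real \<mu> *\<^sub>C x}"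
      unfolding abs_op_svd[OF S svd]
    proof (intro subset_antisym subsetI CollectI)
      fix x assume "x \<in> cspan (u ` ?J)"
      then obtain c where "x = (\<Sum>e\<in>u ` ?J. c e *\<^sub>C e)" using cspan_finite[of "u ` ?J"] fin by blast
      moreover have "?R e = complex_of_real \<mu> *\<^sub>C e" if "e \<in> u ` ?J" for e
        using that svdR by (auto simp: svd_def)
      ultimately show "?R x = complex_of_real \<mu> *\<^sub>C x"
        by (simp add: R.sum bounded_clinear_scaleC[OF bR] scaleC.sum_right scaleC_scaleC mult.commute)
    next
      fix x assume "x \<in> {x. ?R x = complex_of_real \<mu> *\<^sub>C x}"
      then have Rx: "?R x = complex_of_real \<mu> *\<^sub>C x" by simp
      have z: "cinner x (u n) = 0" if "n \<notin> ?J" for n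
      proof -
        have "complex_of_real \<mu> * cinner x (u n) = complex_of_real (s n) * cinner x (u n)"
          using cinner_svd_right[OF bR svdR, of x n] by (simp add: Rx cinner_scaleC_left)
        with that show ?thesis by auto
      qed
      have "(\<lambda>k. (complex_of_real (s k) * cinner x (u k)) *\<^sub>C u k) sums
          (\<Sum>k\<in>?J. (complex_of_real (s k) * cinner x (u k)) *\<^sub>C u k)"
        by (rule sums_finite[OF fin]) (simp add: z)
      with diag_op_sums[OF on on svd_bound[OF svd], of x]
      have "?R x = (\<Sum>k\<in>?J. (complex_of_real (s k) * cinner x (u k)) *\<^sub>C u k)" by (rule sums_unique2)
      also have "\<dots> \<in> cspan (u ` ?J)" by (intro cspan_sum cspan_scaleC cspan_base imageI)
      finally have "complex_of_real (1 / \<mu>) *\<^sub>C ?R x \<in> cspan (u ` ?J)" by (rule cspan_scaleC)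
      also have "complex_of_real (1 / \<mu>) *\<^sub>C ?R x = x"
        using \<mu> unfolding Rx scaleC_scaleC of_real_mult[symmetric] by simp
      finally show "x \<in> cspan (u ` ?J)" .
    qed
  qed
qed

text \<open>Transfers summability between two sequences of singular values of one operator by
  grouping a partial sum according to the values taken.\<close>

lemma summable_powr_of_equal_fibers:
  fixes s t :: "nat \<Rightarrow> real"
  assumes nonneg: "\<And>n. 0 \<le> s n"
    and fin: "\<And>\<mu>. \<mu> > 0 \<Longrightarrow> finite {n. s n = \<mu>} \<and> finite {n. t n = \<mu>}"
    and eq: "\<And>\<mu>. \<mu> > 0 \<Longrightarrow> card {n. s n = \<mu>} = card {n. t n = \<mu>}"
    and t: "summable (\<lambda>n. t n powr p)"
  shows "summable (\<lambda>n. s n powr p)"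
proof (rule summableI_nonneg_bounded)
  fix N
  \<comment> \<open>Zero terms contribute 0 and their fibre may be infinite, so only positive values
    are grouped.\<close>
  define F where "F = {n. n < N \<and> s n > 0}"
  have F: "finite F" by (simp add: F_def)
  have pos: "\<mu> > 0" if "\<mu> \<in> s ` F" for \<mu> using that by (auto simp: F_def)
  have "(\<Sum>n<N. s n powr p) = (\<Sum>n\<in>F. s n powr p)"
    using nonneg by (intro sum.mono_neutral_right) (auto simp: F_def less_le)
  also have "\<dots> = (\<Sum>\<mu>\<in>s ` F. \<Sum>n | n \<in> F \<and> s n = \<mu>. s n powr p)"
    by (rule sum.image_gen[OF F])
  also have "\<dots> \<le> (\<Sum>\<mu>\<in>s ` F. \<Sum>n | s n = \<mu>. \<mu> powr p)"
  proof (rule sum_mono)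
    fix \<mu> assume "\<mu> \<in> s ` F"
    have "(\<Sum>n | n \<in> F \<and> s n = \<mu>. s n powr p) = (\<Sum>n | n \<in> F \<and> s n = \<mu>. \<mu> powr p)"
      by (rule sum.cong) auto
    also have "\<dots> \<le> (\<Sum>n | s n = \<mu>. \<mu> powr p)"
      using fin[OF pos[OF \<open>\<mu> \<in> s ` F\<close>]] by (intro sum_mono2) auto
    finally show "(\<Sum>n | n \<in> F \<and> s n = \<mu>. s n powr p) \<le> (\<Sum>n | s n = \<mu>. \<mu> powr p)" .
  qed
  also have "\<dots> = (\<Sum>\<mu>\<in>s ` F. \<Sum>n | t n = \<mu>. \<mu> powr p)"
    using eq pos by (intro sum.cong[OF refl]) simp
  also have "\<dots> = (\<Sum>\<mu>\<in>s ` F. \<Sum>n | t n = \<mu>. t n powr p)"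
    by (intro sum.cong refl) auto
  also have "\<dots> = (\<Sum>n\<in>(\<Union>\<mu>\<in>s ` F. {n. t n = \<mu>}). t n powr p)"
    using fin pos F by (intro sum.UNION_disjoint[symmetric]) auto
  also have "\<dots> \<le> (\<Sum>n. t n powr p)"
    using fin pos F by (intro sum_le_suminf t) auto
  finally show "(\<Sum>n<N. s n powr p) \<le> (\<Sum>n. t n powr p)" .
qed simp

text \<open>Membership asks for some sequence of singular values with summable powers. Any such
  sequence has the same fibre sizes as s, both being dimensions of the same eigenspaces.\<close>

lemma schatten_iff_svd_summable:
  fixes S :: "'a::chilbert_space \<Rightarrow> 'a"
  assumes S: "compact_op S" and svd: "svd S s u v"
  shows "S \<in> schatten p \<longleftrightarrow> summable (\<lambda>n. s n powr p)"
proof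
  have S': "bounded_clinear S" using S by (simp add: compact_op_def)
  have sv: "singular_value_seq S s" by (rule svd_singular_value_seq[OF S' svd])
  then show "summable (\<lambda>n. s n powr p) \<Longrightarrow> S \<in> schatten p" using S by (auto simp: schatten_def)
  assume "S \<in> schatten p"
  then obtain t where t: "singular_value_seq S t" "summable (\<lambda>n. t n powr p)"
    by (auto simp: schatten_def)
  show "summable (\<lambda>n. s n powr p)"
  proof (rule summable_powr_of_equal_fibers[OF _ _ _ t(2)])
    show "0 \<le> s n" for n using svd by (simp add: svd_def)
    fix \<mu> :: real assume "\<mu> > 0"
    with sv t(1) show "finite {n. s n = \<mu>} \<and> finite {n. t n = \<mu>}"
      by (auto simp: singular_value_seq_def)
    from sv t(1) \<open>\<mu> > 0\<close> show "card {n. s n = \<mu>} = card {n. t n = \<mu>}"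
      unfolding singular_value_seq_def by (metis card_orthonormal_cspan_eq)
  qed
qed

section \<open>Jensen's inequality along Bessel sequences\<close>

text \<open>Jensen's inequality for the weights divided by their sum A; undoing the normalization
  costs the factor A powr (p - 1), which is at most 1 because A is.\<close>

lemma powr_sum_le_subconvex:
  fixes a x :: "'i \<Rightarrow> real"
  assumes p: "1 \<le> p" and "finite I" and a: "\<And>i. i \<in> I \<Longrightarrow> 0 \<le> a i" and x: "\<And>i. i \<in> I \<Longrightarrow> 0 \<le> x i"
    and le: "(\<Sum>i\<in>I. a i) \<le> 1"
  shows "(\<Sum>i\<in>I. a i * x i) powr p \<le> (\<Sum>i\<in>I. a i * x i powr p)"
proof -
  \<comment> \<open>Dropping the zero terms leaves strictly positive points and, unless nothing is
    left, a strictly positive total weight by which one can divide.\<close>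
  define T where "T = {i\<in>I. 0 < a i \<and> 0 < x i}"
  define A where "A = (\<Sum>i\<in>T. a i)"
  have T: "finite T" "T \<subseteq> I" using assms(2) by (auto simp: T_def)
  have eq1: "(\<Sum>i\<in>I. a i * x i) = (\<Sum>i\<in>T. a i * x i)"
    using assms(2) a x by (intro sum.mono_neutral_right) (auto simp: T_def less_le)
  have eq2: "(\<Sum>i\<in>I. a i * x i powr p) = (\<Sum>i\<in>T. a i * x i powr p)"
    using assms(2) a x by (intro sum.mono_neutral_right) (auto simp: T_def less_le)
  have "A \<le> (\<Sum>i\<in>I. a i)" unfolding A_def using T a assms(2) by (intro sum_mono2) auto
  with le have A1: "A \<le> 1" by linarith
  show ?thesis
  proof (cases "T = {}")
    case True
    then show ?thesis by (simp add: eq1 eq2)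
  next
    case False
    have A0: "0 < A" unfolding A_def using T False by (intro sum_pos) (auto simp: T_def)
    have "(\<Sum>i\<in>T. (a i / A) *\<^sub>R x i) powr p \<le> (\<Sum>i\<in>T. (a i / A) * x i powr p)"
      using A0 T False
      by (intro convex_on_sum[OF _ _ powr_convex[OF p]])
        (auto simp: T_def A_def sum_divide_distrib[symmetric])
    also have "(\<Sum>i\<in>T. (a i / A) *\<^sub>R x i) = (\<Sum>i\<in>T. a i * x i) / A"
      by (simp add: sum_divide_distrib)
    also have "(\<Sum>i\<in>T. (a i / A) * x i powr p) = (\<Sum>i\<in>T. a i * x i powr p) / A"
      by (simp add: sum_divide_distrib)
    also have "((\<Sum>i\<in>T. a i * x i) / A) powr p = (\<Sum>i\<in>T. a i * x i) powr p / A powr p"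
      by (rule powr_divide)
    finally have "(\<Sum>i\<in>T. a i * x i) powr p \<le> (\<Sum>i\<in>T. a i * x i powr p) * (A powr p / A)"
      using A0 by (simp add: field_simps)
    also have "\<dots> \<le> (\<Sum>i\<in>T. a i * x i powr p) * 1"
    proof (intro mult_left_mono)
      have "A powr p \<le> A powr 1" using A0 A1 p by (intro powr_mono') auto
      then show "A powr p / A \<le> 1" using A0 by simp
    qed (auto simp: T_def intro!: sum_nonneg)
    finally show ?thesis by (simp add: eq1 eq2)
  qed
qed

lemma sum_mult_le_one:
  fixes a b :: "'i \<Rightarrow> real"
  assumes "(\<Sum>i\<in>I. (a i)\<^sup>2) \<le> 1" "(\<Sum>i\<in>I. (b i)\<^sup>2) \<le> 1"
  shows "(\<Sum>i\<in>I. a i * b i) \<le> 1"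
proof -
  have "(\<Sum>i\<in>I. a i * b i) \<le> (\<Sum>i\<in>I. ((a i)\<^sup>2 + (b i)\<^sup>2) / 2)"
  proof (rule sum_mono)
    fix i
    have "0 \<le> (a i - b i)\<^sup>2" by simp
    then show "a i * b i \<le> ((a i)\<^sup>2 + (b i)\<^sup>2) / 2" by (simp add: power2_diff)
  qed
  also have "\<dots> = ((\<Sum>i\<in>I. (a i)\<^sup>2) + (\<Sum>i\<in>I. (b i)\<^sup>2)) / 2"
    by (simp only: sum_divide_distrib[symmetric] sum.distrib)
  also have "\<dots> \<le> (1 + 1) / 2" by (intro divide_right_mono add_mono assms) simp
  finally show ?thesis by simp
qed

text \<open>The matrix with entries |<f k, u n>| |<v n, g k>| is doubly substochastic.\<close>
lemma bessel_seq_powr_sum_le: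
  fixes c :: "nat \<Rightarrow> complex"
  assumes p: "1 \<le> p" and B: "bessel_seq f" "bessel_seq g" "bessel_seq u" "bessel_seq v"
  shows "(\<Sum>k<K. cmod (\<Sum>n<N. c n * cinner (f k) (u n) * cinner (v n) (g k)) powr p)
    \<le> (\<Sum>n<N. cmod (c n) powr p)"
proof -
  define a where "a k n = cmod (cinner (f k) (u n)) * cmod (cinner (v n) (g k))" for k n
  have a0: "0 \<le> a k n" for k n by (simp add: a_def)
  \<comment> \<open>Rows use the Bessel bounds of \<open>u\<close> and \<open>v\<close> at f k and g
    k; columns use those of \<open>f\<close> and \<open>g\<close> at u n and v n. Every vector
    involved has norm at most 1.\<close>
  have row: "(\<Sum>n<N. a k n) \<le> 1" for k
    unfolding a_def
    by (rule sum_mult_le_one)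
      (simp_all add: norm_cinner_commute[of "v _"] B bessel_seq_sum_le_one bessel_seq_norm_le)
  have col: "(\<Sum>k<K. a k n) \<le> 1" for n
    unfolding a_def
    by (rule sum_mult_le_one)
      (simp_all add: norm_cinner_commute[of "f _"] B bessel_seq_sum_le_one bessel_seq_norm_le)
  have "(\<Sum>k<K. cmod (\<Sum>n<N. c n * cinner (f k) (u n) * cinner (v n) (g k)) powr p)
      \<le> (\<Sum>k<K. (\<Sum>n<N. a k n * cmod (c n)) powr p)"
  proof (intro sum_mono powr_mono2)
    fix k
    have "cmod (\<Sum>n<N. c n * cinner (f k) (u n) * cinner (v n) (g k))
        \<le> (\<Sum>n<N. cmod (c n * cinner (f k) (u n) * cinner (v n) (g k)))" by (rule norm_sum)
    also have "\<dots> = (\<Sum>n<N. a k n * cmod (c n))" by (simp add: a_def norm_mult mult_ac)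
    finally show "cmod (\<Sum>n<N. c n * cinner (f k) (u n) * cinner (v n) (g k))
      \<le> (\<Sum>n<N. a k n * cmod (c n))" .
  qed (use p in auto)
  also have "\<dots> \<le> (\<Sum>k<K. \<Sum>n<N. a k n * cmod (c n) powr p)"
    by (intro sum_mono powr_sum_le_subconvex p row) (auto simp: a0)
  also have "\<dots> = (\<Sum>n<N. (\<Sum>k<K. a k n) * cmod (c n) powr p)"
    by (subst sum.swap) (simp add: sum_distrib_right)
  also have "\<dots> \<le> (\<Sum>n<N. 1 * cmod (c n) powr p)"
    by (intro sum_mono mult_right_mono col) auto
  finally show ?thesis by simp
qed

text \<open>The number K of test vectors is fixed while the expansion length tends to infinity. The
  expansions are requested for k < K alone, since for Hermitian forms they will be available only on
  a finite-dimensional span containing these vectors.\<close>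

lemma bessel_seq_powr_suminf_le:
  fixes c :: "nat \<Rightarrow> complex"
  assumes p: "1 \<le> p" and B: "bessel_seq f" "bessel_seq g" "bessel_seq u" "bessel_seq v"
    and c: "\<And>N. (\<Sum>n<N. cmod (c n) powr p) \<le> M"
    and z: "\<And>k. k < K \<Longrightarrow> (\<lambda>n. c n * cinner (f k) (u n) * cinner (v n) (g k)) sums z k"
  shows "(\<Sum>k<K. cmod (z k) powr p) \<le> M"
proof (rule LIMSEQ_le_const2)
  show "(\<lambda>N. \<Sum>k<K. cmod (\<Sum>n<N. c n * cinner (f k) (u n) * cinner (v n) (g k)) powr p)
      \<longlonglongrightarrow> (\<Sum>k<K. cmod (z k) powr p)"
    using z p unfolding sums_def
    by (intro tendsto_sum tendsto_powr' tendsto_norm tendsto_const) auto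
  show "\<exists>N0. \<forall>N\<ge>N0. (\<Sum>k<K. cmod (\<Sum>n<N. c n * cinner (f k) (u n) * cinner (v n) (g k)) powr p) \<le> M"
    using bessel_seq_powr_sum_le[OF p B] c order_trans by blast
qed

lemma schatten_bessel_seq_bound:
  fixes S :: "'a::chilbert_space \<Rightarrow> 'a"
  assumes p: "1 \<le> p" and S: "S \<in> schatten p"
  obtains M where "\<And>f K. bessel_seq f \<Longrightarrow> (\<Sum>k<K. cmod (cinner (S (f k)) (f k)) powr p) \<le> M"
proof -
  have co: "compact_op S" and bc: "bounded_clinear S" using S by (auto simp: schatten_def compact_op_def)
  obtain s u v where svd: "svd S s u v" by (rule compact_op_svd[OF co])
  have sum: "summable (\<lambda>n. s n powr p)" using schatten_iff_svd_summable[OF co svd] S by simp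
  have on: "on_seq u" "on_seq v" and s0: "\<And>n. 0 \<le> s n" using svd by (auto simp: svd_def)
  have "(\<Sum>k<K. cmod (cinner (S (f k)) (f k)) powr p) \<le> (\<Sum>n. s n powr p)" if f: "bessel_seq f" for f K
  proof (rule bessel_seq_powr_suminf_le[OF p f f on[THEN on_seq_imp_bessel_seq]])
    show "(\<Sum>n<N. cmod (complex_of_real (s n)) powr p) \<le> (\<Sum>n. s n powr p)" for N
      using s0 by (auto intro!: sum_le_suminf sum)
    show "(\<lambda>n. complex_of_real (s n) * cinner (f k) (u n) * cinner (v n) (f k)) sums cinner (S (f k)) (f k)"
      for k using cinner_diag_op_sums[OF on svd_bound[OF svd]] svd_eq_diag_op[OF bc svd] by metis
  qed
  then show ?thesis using that by blast
qed

section \<open>Frames and orthonormal bases\<close>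

text \<open>The upper frame bound is an infimum, so admissible constants are taken slightly above 1
  and the excess is sent to zero. Being a frame makes the set of admissible constants
  nonempty.\<close>

lemma frame_imp_bessel_seq:
  assumes f: "is_frame f" and u: "upper_frame_bound f \<le> 1"
  shows "bessel_seq f"
proof -
  let ?A = "{C. upper_admissible f C}"
  obtain C1 C2 where "0 < C1 \<and> C1 \<le> C2 \<and>
     (\<forall>x. summable (\<lambda>n. (cmod (cinner x (f n)))\<^sup>2) \<and>
          C1 * (norm x)\<^sup>2 \<le> (\<Sum>n. (cmod (cinner x (f n)))\<^sup>2) \<and>
          (\<Sum>n. (cmod (cinner x (f n)))\<^sup>2) \<le> C2 * (norm x)\<^sup>2)"
    using f unfolding is_frame_def by (elim exE)
  then have "upper_admissible f C2" by (simp add: upper_admissible_def)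
  then have ne: "?A \<noteq> {}" by blast
  have "(\<Sum>n<N. (cmod (cinner x (f n)))\<^sup>2) \<le> (norm x)\<^sup>2" for x N
  proof (rule field_le_epsilon)
    fix e :: real assume e: "0 < e"
    \<comment> \<open>This makes the excess d |x|^2 at most e; the summand 1 covers x = 0.\<close>
    define d where "d = e / ((norm x)\<^sup>2 + 1)"
    have d: "0 < d" using e by (simp add: d_def add_nonneg_pos)
    then have "Inf ?A < 1 + d" using u by (simp add: upper_frame_bound_def)
    then obtain C where C: "upper_admissible f C" "C < 1 + d" using cInf_lessD[OF ne] by blast
    have "(\<Sum>n<N. (cmod (cinner x (f n)))\<^sup>2) \<le> (\<Sum>n. (cmod (cinner x (f n)))\<^sup>2)"
      using C(1) by (intro sum_le_suminf) (auto simp: upper_admissible_def)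
    also have "\<dots> \<le> C * (norm x)\<^sup>2" using C(1) by (simp add: upper_admissible_def)
    also have "\<dots> \<le> (1 + d) * (norm x)\<^sup>2" using C(2) by (intro mult_right_mono) auto
    also have "\<dots> = (norm x)\<^sup>2 + d * (norm x)\<^sup>2" by (simp add: algebra_simps)
    also have "d * (norm x)\<^sup>2 \<le> d * ((norm x)\<^sup>2 + 1)" using d by (intro mult_left_mono) auto
    also have "\<dots> = e" by (simp add: d_def add_nonneg_eq_0_iff)
    finally show "(\<Sum>n<N. (cmod (cinner x (f n)))\<^sup>2) \<le> (norm x)\<^sup>2 + e" by simp
  qed
  then show ?thesis by (simp add: bessel_seq_def)
qed

lemma orthonormal_norm: "orthonormal B \<Longrightarrow> e \<in> B \<Longrightarrow> norm e = 1"
  using norm_eq_sqrt_cinner[of e] by (simp add: orthonormal_def)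

text \<open>Distinct members are at distance sqrt 2, so points of the dense set within 1/2 of them
  are distinct as well.\<close>

lemma orthonormal_countable:
  fixes B :: "'a::complex_inner set"
  assumes sep: "\<exists>D::'a set. countable D \<and> closure D = UNIV" and B: "orthonormal B"
  shows "countable B"
proof -
  obtain D :: "'a set" where D: "countable D" "closure D = UNIV" using sep by blast
  have "\<exists>d\<in>D. dist d e < 1 / 2" for e
    using D(2) closure_approachable[of e D] half_gt_zero[OF zero_less_one] by blast
  then obtain d where d: "\<And>e. d e \<in> D" "\<And>e. dist (d e) e < 1 / 2" by metis
  have "inj_on d B"
  proof (rule inj_onI, rule ccontr)
    fix e e' assume e: "e \<in> B" "e' \<in> B" "d e = d e'" "e \<noteq> e'"
    have "dist e e' \<le> dist (d e) e + dist (d e') e'" using e(3) by (metis dist_commute dist_triangle)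
    then have "norm (e - e') < 1" using d(2)[of e] d(2)[of e'] by (simp add: dist_norm)
    then have "(norm (e + - e'))\<^sup>2 < 1" by (simp add: abs_square_less_1)
    moreover have "cinner e e' = 0" using B e by (simp add: orthonormal_def)
    ultimately show False
      unfolding norm_add_sq using B e by (simp add: cinner.minus_right orthonormal_norm)
  qed
  moreover have "countable (d ` B)" using d(1) D(1) by (meson countable_subset image_subset_iff)
  ultimately show ?thesis by (simp add: countable_image_inj_eq)
qed

lemma orthonormal_enumerate:
  assumes "countable B" "orthonormal B"
  obtains f :: "nat \<Rightarrow> 'a::complex_inner" and g
  where "on_seq f" "inj_on g B" "\<And>e. e \<in> B \<Longrightarrow> f (g e) = e" "\<And>n. f n \<in> insert 0 B"
proof -
  define g where "g = to_nat_on B"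
  define f where "f n = (if n \<in> g ` B then inv_into B g n else 0)" for n
  have inj: "inj_on g B" using assms(1) by (simp add: g_def inj_on_to_nat_on)
  then have fg: "f (g e) = e" if "e \<in> B" for e using that by (simp add: f_def)
  have ran: "f n \<in> insert 0 B" for n by (auto simp: f_def inj)
  have "cinner (f i) (f j) = 0" if "i \<noteq> j" for i j
  proof (cases "i \<in> g ` B \<and> j \<in> g ` B")
    case True
    then obtain e e' where e: "e \<in> B" "e' \<in> B" "i = g e" "j = g e'" by blast
    with that have "e \<noteq> e'" by blast
    with e assms(2) show ?thesis by (simp add: fg orthonormal_def)
  qed (auto simp: f_def)
  moreover have "f i = 0 \<or> norm (f i) = 1" for i using ran[of i] orthonormal_norm[OF assms(2)] by blast
  ultimately have "on_seq f" by (simp add: on_seq_def)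
  then show ?thesis using inj fg ran by (rule that)
qed

section \<open>Orthonormal bases: completion and Parseval's identity\<close>

lemma is_onb_orthogonal_zero:
  assumes B: "is_onb B" and x: "\<And>e. e \<in> B \<Longrightarrow> cinner x e = 0"
  shows "x = 0"
proof -
  have "closed {y. cinner x y = 0}"
    by (intro closed_Collect_eq linear_continuous_on cinner.bounded_linear_right continuous_on_const)
  moreover have "cspan B \<subseteq> {y. cinner x y = 0}" using cinner_cspan_zero[OF x] by blast
  ultimately have "closure (cspan B) \<subseteq> {y. cinner x y = 0}" by (rule closure_minimal[rotated])
  then have "cinner x x = 0" using B unfolding is_onb_def by blast
  then show ?thesis by (simp add: cinner_eq_zero_iff)
qed

text \<open>Zorn's lemma gives a maximal orthonormal B. Separability makes it a sequence, so every
  vector splits into a series over B and a remainder; a nonzero remainder could be normalized and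
  added to B.\<close>

lemma orthonormal_extend_onb:
  fixes A :: "'a::chilbert_space set"
  assumes sep: "\<exists>D::'a set. countable D \<and> closure D = UNIV" and A: "orthonormal A"
  obtains B where "A \<subseteq> B" "is_onb B"
proof -
  define \<A> where "\<A> = {B. orthonormal B \<and> A \<subseteq> B}"
  have "\<exists>M\<in>\<A>. \<forall>X\<in>\<A>. M \<subseteq> X \<longrightarrow> X = M"
  proof (rule subset_Zorn_nonempty)
    show "\<A> \<noteq> {}" using A by (auto simp: \<A>_def)
    fix \<C> assume C: "\<C> \<noteq> {}" "subset.chain \<A> \<C>"
    have sub: "\<C> \<subseteq> \<A>" and lin: "\<And>X Y. X \<in> \<C> \<Longrightarrow> Y \<in> \<C> \<Longrightarrow> X \<subseteq> Y \<or> Y \<subseteq> X"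
      using C(2) by (auto simp: subset_chain_def)
    have "orthonormal (\<Union>\<C>)"
      unfolding orthonormal_def
    proof (intro conjI ballI impI)
      fix e assume "e \<in> \<Union>\<C>"
      then show "cinner e e = 1" using sub by (auto simp: \<A>_def orthonormal_def)
      fix f assume "f \<in> \<Union>\<C>" "e \<noteq> f"
      with \<open>e \<in> \<Union>\<C>\<close> obtain X where "X \<in> \<C>" "e \<in> X" "f \<in> X" using lin by blast
      with \<open>e \<noteq> f\<close> sub show "cinner e f = 0" by (auto simp: \<A>_def orthonormal_def)
    qed
    moreover have "A \<subseteq> \<Union>\<C>" using C(1) sub by (auto simp: \<A>_def)
    ultimately show "\<Union>\<C> \<in> \<A>" by (simp add: \<A>_def)
  qed
  then obtain B where "B \<in> \<A>" and max': "\<forall>X\<in>\<A>. B \<subseteq> X \<longrightarrow> X = B" ..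
  then have B: "orthonormal B" "A \<subseteq> B" by (simp_all add: \<A>_def)
  have max: "X = B" if "orthonormal X" "B \<subseteq> X" for X
  proof -
    have "X \<in> \<A>" using that B(2) by (simp add: \<A>_def)
    with max' that(2) show ?thesis by blast
  qed
  obtain f g where f: "on_seq f" "\<And>e. e \<in> B \<Longrightarrow> f (g e) = e" "\<And>n. f n \<in> insert 0 B"
    using orthonormal_enumerate[OF orthonormal_countable[OF sep B(1)] B(1)] by metis
  have "x \<in> closure (cspan B)" for x
  proof -
    obtain y z where x: "x = y + z" "(\<lambda>n. cinner x (f n) *\<^sub>C f n) sums y" "\<And>n. cinner z (f n) = 0"
      using on_seq_decompose[OF f(1)] by metis
    have zB: "cinner z e = 0" if "e \<in> B" for e using x(3)[of "g e"] f(2)[OF that] by simp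
    have "z = 0"
    proof (rule ccontr)
      assume z: "z \<noteq> 0"
      define w where "w = (1 / norm z) *\<^sub>R z"
      have ww: "cinner w w = 1" using z by (simp add: w_def cinner_self)
      have wB: "cinner w e = 0" "cinner e w = 0" if "e \<in> B" for e
        using zB[OF that] cinner_zero_commute[of z e]
        by (simp_all add: w_def cinner.scaleR_left cinner.scaleR_right)
      have "orthonormal (insert w B)" using B(1) ww wB by (auto simp: orthonormal_def)
      then have "w \<in> B" using max by blast
      then show False using wB ww by simp
    qed
    have fs: "f n \<in> cspan B" for n
      by (cases "f n = 0") (use f(3)[of n] in \<open>auto intro: cspan_zero cspan_base\<close>)
    have "(\<Sum>n<N. cinner x (f n) *\<^sub>C f n) \<in> cspan B" for N by (intro cspan_sum cspan_scaleC fs)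
    then have "y \<in> closure (cspan B)"
      using x(2) unfolding sums_def closure_sequential
      by (intro exI[of _ "\<lambda>N. \<Sum>n<N. cinner x (f n) *\<^sub>C f n"] conjI allI)
    then show ?thesis using x(1) \<open>z = 0\<close> by simp
  qed
  then have "is_onb B" using B(1) by (auto simp: is_onb_def)
  then show ?thesis using B(2) that by blast
qed

text \<open>Passes from whole bases to arbitrary orthonormal sequences: the finitely many nonzero
  vectors extend to a basis, and the extra terms are nonnegative. Padding vectors are absorbed by h
  0 = 0.\<close>

lemma on_seq_finite_sum_le_onb:
  fixes h :: "'a::chilbert_space \<Rightarrow> real"
  assumes sep: "\<exists>D::'a set. countable D \<and> closure D = UNIV"
    and onb: "\<And>B. is_onb B \<Longrightarrow> h summable_on B \<and> (\<Sum>\<^sub>\<infinity>e\<in>B. h e) \<le> C"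
    and h: "\<And>x. 0 \<le> h x" "h 0 = 0" and f: "on_seq f"
  shows "(\<Sum>k<N. h (f k)) \<le> C"
proof -
  define J where "J = {k. k < N \<and> f k \<noteq> 0}"
  have on: "orthonormal (f ` J)" by (auto simp: orthonormal_def on_seq_cinner[OF f] J_def)
  have inj: "inj_on f J"
  proof (rule inj_onI)
    fix i j assume "i \<in> J" "j \<in> J" "f i = f j"
    then have "cinner (f i) (f j) \<noteq> 0" by (simp add: J_def cinner_eq_zero_iff)
    then show "i = j" using on_seq_cinner[OF f, of i j] by metis
  qed
  obtain B where B: "f ` J \<subseteq> B" "is_onb B" using orthonormal_extend_onb[OF sep on] .
  have "(\<Sum>k<N. h (f k)) = (\<Sum>k\<in>J. h (f k))"
    by (rule sum.mono_neutral_right) (auto simp: J_def h)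
  also have "\<dots> = sum h (f ` J)" by (simp add: sum.reindex[OF inj])
  also have "\<dots> \<le> (\<Sum>\<^sub>\<infinity>e\<in>B. h e)"
    using B onb h by (intro finite_sum_le_infsum) (auto simp: J_def)
  also have "\<dots> \<le> C" using onb B by blast
  finally show ?thesis .
qed

text \<open>Padding zeros do not change the frame sums, so a finite basis of a finite-dimensional
  space also yields an infinite Parseval frame.\<close>

lemma onb_parseval_frame:
  fixes f :: "nat \<Rightarrow> 'a::chilbert_space"
  assumes B: "is_onb B" and f: "on_seq f" "\<And>e. e \<in> B \<Longrightarrow> f (g e) = e"
  shows "is_frame f" "upper_frame_bound f \<le> 1"
proof -
  have "(\<Sum>n. (cmod (cinner x (f n)))\<^sup>2) = (norm x)\<^sup>2" for x
  proof -
    obtain y z where x: "x = y + z" "(\<lambda>n. cinner x (f n) *\<^sub>C f n) sums y" "\<And>n. cinner z (f n) = 0"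
      using on_seq_decompose[OF f(1)] by metis
    have "z = 0" using f(2) x(3) by (intro is_onb_orthogonal_zero[OF B]) metis
    then have "(\<lambda>n. cinner (cinner x (f n) *\<^sub>C f n) x) sums cinner x x"
      using cinner_sums_left[OF x(2), of x] x(1) by simp
    moreover have "cinner (cinner x (f n) *\<^sub>C f n) x = complex_of_real ((cmod (cinner x (f n)))\<^sup>2)" for n
      unfolding cinner_scaleC_left complex_norm_square by (metis cinner_commute)
    ultimately have "(\<lambda>n. complex_of_real ((cmod (cinner x (f n)))\<^sup>2)) sums complex_of_real ((norm x)\<^sup>2)"
      by (simp only: cinner_self)
    from sums_Re[OF this] show ?thesis by (simp only: Re_complex_of_real sums_unique[symmetric])
  qed
  moreover have "summable (\<lambda>n. (cmod (cinner x (f n)))\<^sup>2)" for x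
    by (rule bessel_seq_summable[OF on_seq_imp_bessel_seq[OF f(1)]])
  ultimately show "is_frame f" and adm: "upper_frame_bound f \<le> 1"
    unfolding is_frame_def upper_frame_bound_def
    by (auto intro!: exI[of _ 1] cInf_lower bdd_belowI[of _ 0] simp: upper_admissible_def)
qed

lemma onb_sum_le_frame:
  fixes h :: "'a::chilbert_space \<Rightarrow> real"
  assumes sep: "\<exists>D::'a set. countable D \<and> closure D = UNIV"
    and frame: "\<And>f. is_frame f \<Longrightarrow> upper_frame_bound f \<le> 1 \<Longrightarrow>
      summable (\<lambda>n. h (f n)) \<and> (\<Sum>n. h (f n)) \<le> C"
    and h: "\<And>x. 0 \<le> h x" and B: "is_onb B"
  shows "h summable_on B \<and> (\<Sum>\<^sub>\<infinity>e\<in>B. h e) \<le> C"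
proof -
  have on: "orthonormal B" using B by (simp add: is_onb_def)
  obtain f g where f: "on_seq f" "inj_on g B" "\<And>e. e \<in> B \<Longrightarrow> f (g e) = e"
    using orthonormal_enumerate[OF orthonormal_countable[OF sep on] on] by metis
  have fr: "summable (\<lambda>n. h (f n))" "(\<Sum>n. h (f n)) \<le> C"
    using frame onb_parseval_frame[OF B f(1,3)] by blast+
  have fin: "sum h F \<le> C" if F: "finite F" "F \<subseteq> B" for F
  proof -
    have "sum h F = (\<Sum>e\<in>F. h (f (g e)))" using F f(3) by (intro sum.cong) auto
    also have "\<dots> = (\<Sum>n\<in>g ` F. h (f n))"
      using sum.reindex[OF inj_on_subset[OF f(2) F(2)], of "\<lambda>n. h (f n)"] by simp
    also have "\<dots> \<le> (\<Sum>n. h (f n))" using F h by (intro sum_le_suminf fr(1)) auto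
    finally show ?thesis using fr(2) by linarith
  qed
  then have "bdd_above (sum h ` {F. F \<subseteq> B \<and> finite F})" by (intro bdd_aboveI2[where M = C]) auto
  then have "h summable_on B" using h by (intro nonneg_bdd_above_summable_on) auto
  then show ?thesis using fin infsum_le_finite_sums by blast
qed

section \<open>Approximation by finite-dimensional sets\<close>

text \<open>By induction, one more coefficient exhibits the set as a continuous image of a disc
  times the previous set. The vectors \<open>h g\<close> are arbitrary because both the g themselves
  and their images under S are used.\<close>

lemma compact_combinations:
  fixes h :: "'b \<Rightarrow> 'a::complex_normed_vector"
  assumes "finite G"
  shows "compact {\<Sum>g\<in>G. c g *\<^sub>C h g | c. \<forall>g\<in>G. cmod (c g) \<le> R}"
  using assms
proof (induction G)
  case empty
  have "{\<Sum>g\<in>{}. c g *\<^sub>C h g | c. \<forall>g\<in>{}. cmod (c g) \<le> R} = {0}" by auto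
  then show ?case by (simp only: compact_sing)
next
  case (insert b G)
  let ?K = "\<lambda>G. {\<Sum>g\<in>G. c g *\<^sub>C h g | c. \<forall>g\<in>G. cmod (c g) \<le> R}"
  have "?K (insert b G) = (\<lambda>z. fst z *\<^sub>C h b + snd z) ` (cball 0 R \<times> ?K G)" (is "?L = ?R")
  proof (intro subset_antisym subsetI)
    fix x assume "x \<in> ?L"
    then obtain c where c: "x = (\<Sum>g\<in>insert b G. c g *\<^sub>C h g)" "\<forall>g\<in>insert b G. cmod (c g) \<le> R" by blast
    show "x \<in> ?R"
      by (rule image_eqI[of _ _ "(c b, \<Sum>g\<in>G. c g *\<^sub>C h g)"]) (use c insert.hyps in auto)
  next
    fix x assume "x \<in> ?R"
    then obtain t c where x: "x = t *\<^sub>C h b + (\<Sum>g\<in>G. c g *\<^sub>C h g)" "cmod t \<le> R"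
      "\<forall>g\<in>G. cmod (c g) \<le> R" by auto
    have "(\<Sum>g\<in>G. c g *\<^sub>C h g) = (\<Sum>g\<in>G. (c(b := t)) g *\<^sub>C h g)"
      using insert.hyps by (intro sum.cong) auto
    then have "x = (\<Sum>g\<in>insert b G. (c(b := t)) g *\<^sub>C h g)" using x insert.hyps by simp
    moreover have "\<forall>g\<in>insert b G. cmod ((c(b := t)) g) \<le> R" using x by auto
    ultimately show "x \<in> ?L" by blast
  qed
  moreover have "compact ?R"
    by (intro compact_continuous_image compact_Times compact_cball insert.IH continuous_on_add
        scaleC.continuous_on continuous_on_fst continuous_on_snd continuous_on_id continuous_on_const)
  ultimately show ?case by simp
qed

text \<open>Phrased with compact sets instead of finite-rank operators: only the position of S x has
  to be controlled, and the approximating point may be written down separately for each x.\<close>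

lemma compact_opI_approx:
  fixes S :: "'a::chilbert_space \<Rightarrow> 'a"
  assumes S: "bounded_clinear S"
    and approx: "\<And>\<epsilon>. \<epsilon> > 0 \<Longrightarrow> \<exists>K. compact K \<and> (\<forall>x. norm x \<le> 1 \<longrightarrow> (\<exists>k\<in>K. norm (S x - k) \<le> \<epsilon>))"
  shows "compact_op S"
  unfolding compact_op_def compact_eq_totally_bounded
proof (intro conjI allI impI S)
  show "complete (closure (S ` cball 0 1))" by (simp add: complete_eq_closed)
  fix e :: real assume e: "0 < e"
  obtain K where K: "compact K" "\<And>x. norm x \<le> 1 \<Longrightarrow> \<exists>k\<in>K. norm (S x - k) \<le> e / 3"
    using approx[of "e / 3"] e by auto
  obtain F where F: "finite F" "K \<subseteq> (\<Union>x\<in>F. ball x (e / 3))"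
    using K(1) e unfolding compact_eq_totally_bounded by (metis divide_pos_pos zero_less_numeral)
  \<comment> \<open>Closed balls, because their finite union is closed and so also covers the
    closure; the radius 2 e / 3 leaves room for the open balls of radius e.\<close>
  have "S ` cball 0 1 \<subseteq> (\<Union>x\<in>F. cball x (2 * e / 3))"
  proof
    fix y assume "y \<in> S ` cball 0 1"
    then obtain x' where "norm x' \<le> 1" "y = S x'" by auto
    then obtain k where k: "k \<in> K" "norm (y - k) \<le> e / 3" using K(2) by blast
    then obtain x where x: "x \<in> F" "dist x k < e / 3" using F(2) by auto
    have "dist x y \<le> dist x k + dist k y" by (rule dist_triangle)
    then have "dist x y \<le> 2 * e / 3" using k(2) x(2) by (simp add: dist_norm norm_minus_commute)
    then show "y \<in> (\<Union>x\<in>F. cball x (2 * e / 3))" using x(1) by auto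
  qed
  moreover have "closed (\<Union>x\<in>F. cball x (2 * e / 3))" using F(1) by (intro closed_UN) auto
  ultimately have "closure (S ` cball 0 1) \<subseteq> (\<Union>x\<in>F. cball x (2 * e / 3))" by (rule closure_minimal)
  also have "\<dots> \<subseteq> (\<Union>x\<in>F. ball x e)" using e by (intro UN_mono) auto
  finally show "\<exists>F. finite F \<and> closure (S ` cball 0 1) \<subseteq> (\<Union>x\<in>F. ball x e)" using F(1) by blast
qed

lemma proj_onto_diff_orthogonal:
  assumes "finite G" "orthonormal G" "y \<in> cspan G"
  shows "cinner (x - proj_onto G x) y = 0"
  by (simp add: cinner.diff_left cinner_proj_onto_cspan[OF assms])

lemma gram_schmidt:
  fixes F :: "'a::complex_inner set"
  assumes "finite F"
  obtains G where "finite G" "orthonormal G" "F \<subseteq> cspan G"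
proof -
  have "\<exists>G. finite G \<and> orthonormal G \<and> F \<subseteq> cspan G"
    using assms
  proof (induction F)
    case empty
    show ?case by (intro exI[of _ "{}"]) (auto simp: orthonormal_def)
  next
    case (insert b F)
    then obtain G where G: "finite G" "orthonormal G" "F \<subseteq> cspan G" by blast
    define z where "z = b - proj_onto G b"
    have zG: "cinner z g = 0" if "g \<in> G" for g
      unfolding z_def by (rule proj_onto_diff_orthogonal[OF G(1,2) cspan_base[OF that]])
    show ?case
    proof (cases "z = 0")
      case True
      then have "b \<in> cspan G" using proj_onto_in_cspan[of G b] by (simp add: z_def)
      with G show ?thesis by blast
    next
      case False
      define w where "w = (1 / norm z) *\<^sub>R z"
      have ww: "cinner w w = 1" using False by (simp add: w_def cinner_self)
      have wG: "cinner w g = 0" "cinner g w = 0" if "g \<in> G" for g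
        using zG[OF that] cinner_zero_commute[of z g]
        by (simp_all add: w_def cinner.scaleR_left cinner.scaleR_right)
      have on: "orthonormal (insert w G)" using G(2) ww wG by (auto simp: orthonormal_def)
      have "complex_of_real (norm z) *\<^sub>C w = z"
        using False unfolding w_def scaleR_scaleC[symmetric] by simp
      moreover have "complex_of_real (norm z) *\<^sub>C w \<in> cspan (insert w G)"
        by (intro cspan_scaleC cspan_base) simp
      ultimately have "z \<in> cspan (insert w G)" by simp
      moreover have sub: "cspan G \<subseteq> cspan (insert w G)" by (intro cspan_mono) blast
      ultimately have "z + proj_onto G b \<in> cspan (insert w G)"
        using proj_onto_in_cspan[of G b] by (intro cspan_add) auto
      then have "b \<in> cspan (insert w G)" by (simp add: z_def)
      then show ?thesis using G on sub by (intro exI[of _ "insert w G"]) auto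
    qed
  qed
  then show ?thesis using that by blast
qed

section \<open>Hermitian forms\<close>

text \<open>Forms instead of operators: the Hermitian parts of S can be written down from <S x, y>
  alone, while as operators they would involve an adjoint whose existence had first to be
  proved.\<close>

definition herm_form :: "real \<Rightarrow> ('a::complex_inner \<Rightarrow> 'a \<Rightarrow> complex) \<Rightarrow> bool" where
  "herm_form M a \<longleftrightarrow> 0 \<le> M \<and> (\<forall>x y z. a (x + y) z = a x z + a y z) \<and> (\<forall>c x y. a (c *\<^sub>C x) y = c * a x y) \<and>
     (\<forall>x y. a y x = cnj (a x y)) \<and> (\<forall>x y. cmod (a x y) \<le> M * norm x * norm y)"

lemma herm_form_bounded_linear:
  fixes a :: "'a::complex_inner \<Rightarrow> 'a \<Rightarrow> complex"
  assumes "herm_form M a"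
  shows "bounded_linear (\<lambda>x. a x y)"
proof (rule bounded_linear_intro[where K = "M * norm y"])
  fix x z :: 'a and r :: real
  show "a (x + z) y = a x y + a z y" using assms unfolding herm_form_def by blast
  show "a (r *\<^sub>R x) y = r *\<^sub>R a x y"
    using assms unfolding herm_form_def scaleR_scaleC scaleR_conv_of_real by blast
  have "cmod (a x y) \<le> M * norm x * norm y" using assms unfolding herm_form_def by blast
  then show "cmod (a x y) \<le> norm x * (M * norm y)" by (simp only: mult_ac)
qed

lemma herm_form_sum_right:
  assumes "herm_form M a"
  shows "a x (\<Sum>g\<in>G. c g *\<^sub>C g) = (\<Sum>g\<in>G. cnj (c g) * a x g)"
proof -
  interpret bounded_linear "\<lambda>z. a z x" by (rule herm_form_bounded_linear[OF assms])
  have herm: "a z w = cnj (a w z)" for z w using assms unfolding herm_form_def by blast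
  have scale: "a (t *\<^sub>C z) w = t * a z w" for t z w using assms unfolding herm_form_def by blast
  have "a x (\<Sum>g\<in>G. c g *\<^sub>C g) = cnj (\<Sum>g\<in>G. a (c g *\<^sub>C g) x)"
    unfolding sum[symmetric] by (rule herm)
  also have "\<dots> = (\<Sum>g\<in>G. cnj (c g) * cnj (a g x))" by (simp add: scale)
  also have "\<dots> = (\<Sum>g\<in>G. cnj (c g) * a x g)" by (intro sum.cong refl) (metis herm)
  finally show ?thesis .
qed

text \<open>On the span of G, the compression of a is diagonalized by the singular vectors of its shift
  by (M + 1) times the identity, because that shift is positive and injective.\<close>
lemma herm_form_diagonalize:
  fixes a :: "'a::chilbert_space \<Rightarrow> 'a \<Rightarrow> complex"
  assumes a: "herm_form M a" and G: "finite G" "orthonormal G"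
  obtains e where "on_seq e"
    "\<And>x y. x \<in> cspan G \<Longrightarrow> y \<in> cspan G \<Longrightarrow> (\<lambda>n. a (e n) (e n) * cinner x (e n) * cinner (e n) y) sums a x y"
proof -
  let ?P = "proj_onto G"
  \<comment> \<open>With this shift the form a(x, x) + c |x|^2 is at least |x|^2, since a(x, x) is
    at least -M |x|^2.\<close>
  define c where "c = M + 1"
  \<comment> \<open>The coordinates of \<open>T x\<close>, where T is P (A + c) P for the operator A
    that the form would have and P the projection onto the span of \<open>G\<close>.\<close>
  define k where "k x g = a (?P x) g + complex_of_real c * cinner x g" for x g
  define T where "T x = (\<Sum>g\<in>G. k x g *\<^sub>C g)" for x
  have M: "0 \<le> M" and a_add: "\<And>x y z. a (x + y) z = a x z + a y z"
    and a_scale: "\<And>c x y. a (c *\<^sub>C x) y = c * a x y"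
    and a_herm: "\<And>x y. a y x = cnj (a x y)" and a_bd: "\<And>x y. cmod (a x y) \<le> M * norm x * norm y"
    using a unfolding herm_form_def by blast+
  have P_add: "?P (x + y) = ?P x + ?P y" for x y
    by (simp add: proj_onto_def cinner_add_left scaleC_add_left sum.distrib)
  have P_scale: "?P (t *\<^sub>C x) = t *\<^sub>C ?P x" for t x
    by (simp add: proj_onto_def cinner_scaleC_left scaleC_scaleC scaleC.sum_right)
  have k_bd: "cmod (k x g) \<le> (M + c) * norm x" if "g \<in> G" for x g
  proof -
    have g1: "norm g = 1" using G(2) that by (rule orthonormal_norm)
    have "cmod (k x g) \<le> cmod (a (?P x) g) + c * cmod (cinner x g)"
      unfolding k_def using M norm_triangle_ineq[of "a (?P x) g" "complex_of_real c * cinner x g"]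
      by (simp add: norm_mult c_def)
    also have "\<dots> \<le> M * norm x + c * norm x"
    proof (intro add_mono mult_left_mono)
      have "cmod (a (?P x) g) \<le> M * norm (?P x)" using a_bd[of "?P x" g] g1 by simp
      also have "\<dots> \<le> M * norm x" using M norm_proj_onto_le(1)[OF G] by (intro mult_left_mono)
      finally show "cmod (a (?P x) g) \<le> M * norm x" .
      show "cmod (cinner x g) \<le> norm x" using norm_cinner_le[of x g] g1 by simp
    qed (use M in \<open>simp add: c_def\<close>)
    finally show ?thesis by (simp add: distrib_right)
  qed
  have bT: "bounded_clinear T"
    unfolding bounded_clinear_def clinear_def
  proof (intro conjI allI exI)
    fix x y t
    show "T (x + y) = T x + T y"
      by (simp add: T_def k_def P_add a_add cinner_add_left distrib_left scaleC_add_left sum.distrib)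
    have "k (t *\<^sub>C x) g = t * k x g" for g
      by (simp add: k_def P_scale a_scale cinner_scaleC_left distrib_left mult_ac)
    then show "T (t *\<^sub>C x) = t *\<^sub>C T x" by (simp add: T_def scaleC.sum_right scaleC_scaleC)
    have "norm (T x) \<le> (\<Sum>g\<in>G. norm (k x g *\<^sub>C g))" unfolding T_def by (rule norm_sum)
    also have "\<dots> \<le> (\<Sum>g\<in>G. (M + c) * norm x)"
      by (intro sum_mono) (simp add: norm_scaleC orthonormal_norm[OF G(2)] k_bd)
    finally show "norm (T x) \<le> norm x * (real (card G) * (M + c))" by (simp add: mult_ac)
  qed
  have T_inner: "cinner (T x) y = a (?P x) (?P y) + complex_of_real c * cinner (?P x) (?P y)" for x y
  proof -
    have "cinner (T x) y = (\<Sum>g\<in>G. a (?P x) g * cinner g y) + complex_of_real c * (\<Sum>g\<in>G. cinner x g * cinner g y)"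
      by (simp add: T_def k_def cinner.sum_left cinner_scaleC_left distrib_right distrib_left sum.distrib
          sum_distrib_left mult_ac)
    also have "(\<Sum>g\<in>G. a (?P x) g * cinner g y) = a (?P x) (?P y)"
      unfolding proj_onto_def[of G y] herm_form_sum_right[OF a]
      by (intro sum.cong refl) (metis cinner_commute mult.commute)
    also have "(\<Sum>g\<in>G. cinner x g * cinner g y) = cinner (?P x) (?P y)"
      unfolding cinner_proj_onto_right by (intro sum.cong refl) (simp add: cinner_proj_onto[OF G])
    finally show ?thesis .
  qed
  have im: "Im (a z z) = 0" for z
    using arg_cong[OF a_herm[of z z], of Im] by simp
  have re: "- (M * (norm z)\<^sup>2) \<le> Re (a z z)" for z
    using a_bd[of z z] abs_Re_le_cmod[of "a z z"] by (simp add: power2_eq_square)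
  have T_re: "(norm (?P x))\<^sup>2 \<le> Re (cinner (T x) x)" for x
    using re[of "?P x"] by (simp add: T_inner cinner_self c_def distrib_right)
  have posT: "positive_op T"
    unfolding positive_op_def
  proof (intro conjI allI bT)
    fix x
    show "Im (cinner (T x) x) = 0" by (simp add: T_inner cinner_self im)
    show "0 \<le> Re (cinner (T x) x)" using T_re[of x] zero_le_power2[of "norm (?P x)"] by linarith
  qed
  have "compact_op T"
  proof (rule compact_opI_approx[OF bT])
    fix \<epsilon> :: real assume "\<epsilon> > 0"
    have "\<exists>t\<in>{\<Sum>g\<in>G. d g *\<^sub>C g | d. \<forall>g\<in>G. cmod (d g) \<le> M + c}. norm (T x - t) \<le> \<epsilon>" if "norm x \<le> 1" for x
    proof (rule bexI)
      have "(M + c) * norm x \<le> (M + c) * 1" using that M by (intro mult_left_mono) (auto simp: c_def)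
      then show "T x \<in> {\<Sum>g\<in>G. d g *\<^sub>C g | d. \<forall>g\<in>G. cmod (d g) \<le> M + c}"
        unfolding T_def using k_bd by (intro CollectI exI[of _ "k x"]) (auto intro: order_trans[OF k_bd])
      show "norm (T x - T x) \<le> \<epsilon>" using \<open>\<epsilon> > 0\<close> by simp
    qed
    then show "\<exists>K. compact K \<and> (\<forall>x. norm x \<le> 1 \<longrightarrow> (\<exists>k\<in>K. norm (T x - k) \<le> \<epsilon>))"
      using compact_combinations[OF G(1), of "\<lambda>g. g" "M + c"] by (intro exI conjI allI impI)
  qed
  then obtain s u v where svd: "svd T s u v" by (rule compact_op_svd)
  have on: "on_seq u" using svd by (simp add: svd_def)
  \<comment> \<open>Symmetry of T makes u n an eigenvector of the square of T with eigenvalue (s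
    n)^2, and positivity takes the root: the left singular vector can be replaced by u n.\<close>
  have Tu: "T (u n) = complex_of_real (s n) *\<^sub>C u n" for n
  proof (cases "s n = 0")
    case True
    then have "u n = 0" by (simp add: svd_eq_0_iff[OF svd])
    then show ?thesis using bounded_clinear_scaleC[OF bT, of 0 0] by simp
  next
    case False
    have "T (T (u n)) = complex_of_real ((s n)\<^sup>2) *\<^sub>C u n"
    proof (rule cinner_eqI)
      fix y
      have "cinner (T (T (u n))) y = cinner (T (u n)) (T y)" by (rule positive_op_symmetric[OF posT])
      also have "\<dots> = complex_of_real (s n) * cnj (cinner (T y) (v n))"
        using svd by (simp add: svd_def cinner_scaleC_left cinner_commute[symmetric])
      also have "\<dots> = complex_of_real ((s n)\<^sup>2) * cinner (u n) y"
        unfolding cinner_svd_right[OF bT svd]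
        by (simp add: power2_eq_square cinner_commute[symmetric])
      finally show "cinner (T (T (u n))) y = cinner (complex_of_real ((s n)\<^sup>2) *\<^sub>C u n) y"
        by (simp add: cinner_scaleC_left)
    qed
    moreover have "0 < s n" using False svd by (simp add: svd_def less_le)
    ultimately show ?thesis using positive_op_eigen_of_square[OF posT] by blast
  qed
  have Pu: "?P (u n) = u n" for n
  proof (cases "s n = 0")
    case True
    then have "u n = 0" by (simp add: svd_eq_0_iff[OF svd])
    then show ?thesis by (simp add: proj_onto_def)
  next
    case False
    have "T (u n) \<in> cspan G" unfolding T_def by (intro cspan_sum cspan_scaleC cspan_base)
    then have "complex_of_real (1 / s n) *\<^sub>C T (u n) \<in> cspan G" by (rule cspan_scaleC)
    also have "complex_of_real (1 / s n) *\<^sub>C T (u n) = u n"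
      using False unfolding Tu scaleC_scaleC of_real_mult[symmetric] by simp
    finally show ?thesis by (rule proj_onto_cspan[OF G])
  qed
  \<comment> \<open>Undoing the shift: within the span of \<open>G\<close>, u n is an eigenvector of
    the form with eigenvalue s n - c.\<close>
  have au: "a (u n) y = complex_of_real (s n - c) * cinner (u n) y" if "y \<in> cspan G" for n y
    using T_inner[of "u n" y] by (simp add: Tu Pu proj_onto_cspan[OF G that] cinner_scaleC_left algebra_simps)
  show ?thesis
  proof (rule that[OF on])
    fix x y assume x: "x \<in> cspan G" and y: "y \<in> cspan G"
    \<comment> \<open>The remainder z is killed by T, so the lower bound \<open>T_re\<close> gives P
      z = 0 and z is orthogonal to x. As z is also orthogonal to w, it vanishes: the u n span
      everything in the span of \<open>G\<close>.\<close>
    obtain w z where wz: "x = w + z" "(\<lambda>n. cinner x (u n) *\<^sub>C u n) sums w" "\<And>n. cinner z (u n) = 0"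
      using on_seq_decompose[OF on] by metis
    have "T z = 0" using svd wz(3) by (simp add: svd_def)
    then have "?P z = 0" using T_re[of z] by simp
    then have "cinner z x = 0" using cinner_proj_onto_cspan[OF G x, of z] by simp
    moreover have "cinner w z = 0"
    proof -
      have "cinner (cinner x (u n) *\<^sub>C u n) z = 0" for n
        using wz(3)[of n] cinner_zero_commute[of z "u n"] by (simp add: cinner_scaleC_left)
      then have "(\<lambda>n. 0) sums cinner w z" using cinner_sums_left[OF wz(2), of z] by simp
      then show ?thesis using sums_unique2 sums_zero by blast
    qed
    ultimately have "cinner z z = 0"
      using cinner_zero_commute[of z w] by (simp add: wz(1) cinner_add_right)
    then have "x = w" using wz(1) by (simp add: cinner_eq_zero_iff)
    then have "(\<lambda>n. cinner x (u n) *\<^sub>C u n) sums x" using wz(2) by simp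
    then have "(\<lambda>n. a (cinner x (u n) *\<^sub>C u n) y) sums a x y"
      by (rule bounded_linear.sums[OF herm_form_bounded_linear[OF a]])
    moreover have "a (cinner x (u n) *\<^sub>C u n) y = a (u n) (u n) * cinner x (u n) * cinner (u n) y" for n
    proof -
      have "u n \<in> cspan G" using proj_onto_in_cspan[of G "u n"] by (simp add: Pu)
      then show ?thesis unfolding a_scale
        by (cases "u n = 0") (simp_all add: au y on_seq_cinner_self[OF on] mult_ac)
    qed
    ultimately show "(\<lambda>n. a (u n) (u n) * cinner x (u n) * cinner (u n) y) sums a x y" by simp
  qed
qed

text \<open>The first N vectors of both sequences lie in one finite-dimensional span. There a is
  diagonal in some orthonormal \<open>e\<close>, and \<open>quad\<close> bounds its diagonal entries
  by the same C whatever the span, N or M.\<close>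

lemma herm_form_bilinear_bound:
  fixes a :: "'a::chilbert_space \<Rightarrow> 'a \<Rightarrow> complex"
  assumes p: "1 \<le> p" and a: "herm_form M a"
    and quad: "\<And>e N. on_seq e \<Longrightarrow> (\<Sum>k<N. cmod (a (e k) (e k)) powr p) \<le> C"
    and u: "on_seq u" and v: "on_seq v"
  shows "(\<Sum>k<N. cmod (a (u k) (v k)) powr p) \<le> C"
proof -
  obtain G where G: "finite G" "orthonormal G" "u ` {..<N} \<union> v ` {..<N} \<subseteq> cspan G"
    by (rule gram_schmidt[of "u ` {..<N} \<union> v ` {..<N}"]) auto
  obtain e where e: "on_seq e"
    "\<And>x y. x \<in> cspan G \<Longrightarrow> y \<in> cspan G \<Longrightarrow> (\<lambda>n. a (e n) (e n) * cinner x (e n) * cinner (e n) y) sums a x y"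
    using herm_form_diagonalize[OF a G(1,2)] by metis
  show ?thesis
  proof (rule bessel_seq_powr_suminf_le[OF p u[THEN on_seq_imp_bessel_seq] v[THEN on_seq_imp_bessel_seq]
        e(1)[THEN on_seq_imp_bessel_seq] e(1)[THEN on_seq_imp_bessel_seq]])
    show "(\<Sum>n<N. cmod (a (e n) (e n)) powr p) \<le> C" for N by (rule quad[OF e(1)])
    fix k assume "k < N"
    then show "(\<lambda>n. a (e n) (e n) * cinner (u k) (e n) * cinner (e n) (v k)) sums a (u k) (v k)"
      using G(3) by (intro e(2)) auto
  qed
qed

section \<open>From the quadratic bound to compactness and Schatten class\<close>

lemma powr_add_le:
  fixes x y :: real
  assumes "0 \<le> x" "0 \<le> y" "1 \<le> p"
  shows "(x + y) powr p \<le> 2 powr p * (x powr p + y powr p)"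
proof -
  have "(x + y) powr p \<le> (2 * max x y) powr p" using assms by (intro powr_mono2) auto
  also have "\<dots> = 2 powr p * max x y powr p" using assms by (simp add: powr_mult)
  also have "\<dots> \<le> 2 powr p * (x powr p + y powr p)" by (intro mult_left_mono) (auto simp: max_def)
  finally show ?thesis .
qed

text \<open>Each of the two Hermitian parts of S contributes C, and \<open>powr_add_le\<close> puts
  them together at the price of 2 powr p.\<close>

lemma quadratic_bound_imp_bilinear_bound:
  fixes S :: "'a::chilbert_space \<Rightarrow> 'a"
  assumes p: "1 \<le> p" and S: "bounded_clinear S"
    and quad: "\<And>e N. on_seq e \<Longrightarrow> (\<Sum>k<N. cmod (cinner (S (e k)) (e k)) powr p) \<le> C"
    and u: "on_seq u" and v: "on_seq v"
  shows "(\<Sum>k<N. cmod (cinner (S (u k)) (v k)) powr p) \<le> 2 powr p * (C + C)"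
proof -
  obtain L where L: "L > 0" "\<And>x. norm (S x) \<le> L * norm x" using bounded_clinear_pos_bound[OF S] by metis
  \<comment> \<open>The Hermitian part of \<alpha> S. The choices \<alpha> = 1 and \<alpha> = -i
    give the real and the imaginary part of S.\<close>
  define a where "a \<alpha> x y = (\<alpha> * cinner (S x) y + cnj (\<alpha> * cinner (S y) x)) / 2" for \<alpha> x y
  have bd: "cmod (cinner (S x) y) \<le> L * norm x * norm y" for x y
    using norm_cinner_le[of "S x" y] mult_right_mono[OF L(2)[of x], of "norm y"] by simp
  have herm: "herm_form L (a \<alpha>)" if "cmod \<alpha> = 1" for \<alpha>
    unfolding herm_form_def
  proof (intro conjI allI)
    show "0 \<le> L" using L(1) by simp
    show "a \<alpha> (x + y) z = a \<alpha> x z + a \<alpha> y z" for x y z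
      using S by (simp add: a_def bounded_clinear_def clinear_def cinner_add_left cinner_add_right
          distrib_left add_divide_distrib)
    show "a \<alpha> (c *\<^sub>C x) y = c * a \<alpha> x y" for c x y
      by (simp add: a_def bounded_clinear_scaleC[OF S] cinner_scaleC_left cinner_scaleC_right
          distrib_left mult_ac)
    show "a \<alpha> y x = cnj (a \<alpha> x y)" for x y by (simp add: a_def add.commute)
    fix x y
    have "cmod (\<alpha> * cinner (S x) y + cnj (\<alpha> * cinner (S y) x)) \<le> L * norm x * norm y + L * norm y * norm x"
      by (rule norm_triangle_mono) (simp_all add: norm_mult that bd)
    then show "cmod (a \<alpha> x y) \<le> L * norm x * norm y"
      by (simp add: a_def norm_divide mult_ac)
  qed
  have diag: "(\<Sum>k<N. cmod (a \<alpha> (e k) (e k)) powr p) \<le> C" if "cmod \<alpha> = 1" "on_seq e" for \<alpha> e N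
  proof -
    \<comment> \<open>On the diagonal the form is the real part of \<alpha> <S x, x>, so (ii) passes
      to it with the same constant.\<close>
    have "cmod (a \<alpha> x x) \<le> cmod (cinner (S x) x)" for x
    proof -
      have "cmod (\<alpha> * cinner (S x) x + cnj (\<alpha> * cinner (S x) x)) \<le> cmod (cinner (S x) x) + cmod (cinner (S x) x)"
        by (rule norm_triangle_mono) (simp_all add: norm_mult that)
      then show ?thesis by (simp add: a_def norm_divide)
    qed
    then have "(\<Sum>k<N. cmod (a \<alpha> (e k) (e k)) powr p) \<le> (\<Sum>k<N. cmod (cinner (S (e k)) (e k)) powr p)"
      using p by (intro sum_mono powr_mono2) auto
    also have "\<dots> \<le> C" by (rule quad[OF that(2)])
    finally show ?thesis .
  qed
  have split: "cinner (S x) y = a 1 x y + \<i> * a (- \<i>) x y" for x y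
    by (simp add: a_def add_divide_distrib diff_divide_distrib distrib_left right_diff_distrib)
  have "(\<Sum>k<N. cmod (cinner (S (u k)) (v k)) powr p)
      \<le> (\<Sum>k<N. 2 powr p * (cmod (a 1 (u k) (v k)) powr p + cmod (a (- \<i>) (u k) (v k)) powr p))"
  proof (rule sum_mono)
    fix k
    have "cmod (cinner (S (u k)) (v k)) \<le> cmod (a 1 (u k) (v k)) + cmod (a (- \<i>) (u k) (v k))"
      unfolding split[of "u k" "v k"] by (rule norm_triangle_mono) (simp_all add: norm_mult)
    then have "cmod (cinner (S (u k)) (v k)) powr p
        \<le> (cmod (a 1 (u k) (v k)) + cmod (a (- \<i>) (u k) (v k))) powr p"
      using p by (intro powr_mono2) auto
    also have "\<dots> \<le> 2 powr p * (cmod (a 1 (u k) (v k)) powr p + cmod (a (- \<i>) (u k) (v k)) powr p)"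
      using p by (intro powr_add_le) auto
    finally show "cmod (cinner (S (u k)) (v k)) powr p
      \<le> 2 powr p * (cmod (a 1 (u k) (v k)) powr p + cmod (a (- \<i>) (u k) (v k)) powr p)" .
  qed
  also have "\<dots> = 2 powr p * ((\<Sum>k<N. cmod (a 1 (u k) (v k)) powr p) + (\<Sum>k<N. cmod (a (- \<i>) (u k) (v k)) powr p))"
    by (simp only: sum_distrib_left[symmetric] sum.distrib)
  also have "\<dots> \<le> 2 powr p * (C + C)"
  proof (intro mult_left_mono add_mono)
    show "(\<Sum>k<N. cmod (a 1 (u k) (v k)) powr p) \<le> C"
      by (rule herm_form_bilinear_bound[OF p herm _ u v]) (simp_all add: diag)
    show "(\<Sum>k<N. cmod (a (- \<i>) (u k) (v k)) powr p) \<le> C"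
      by (rule herm_form_bilinear_bound[OF p herm _ u v]) (simp_all add: diag)
  qed simp
  finally show ?thesis .
qed

text \<open>N orthonormal pairs with |<S (u k), v k>| above \<epsilon> give N \<epsilon> powr p at
  most C. Hence the form is small off a finite set of directions, and S is close to an operator with
  finite-dimensional range.\<close>

lemma bilinear_bound_imp_compact_op:
  fixes S :: "'a::chilbert_space \<Rightarrow> 'a"
  assumes S: "bounded_clinear S"
    and bound: "\<And>u v N. on_seq u \<Longrightarrow> on_seq v \<Longrightarrow> (\<Sum>k<N. cmod (cinner (S (u k)) (v k)) powr p) \<le> C"
    and p: "1 \<le> p"
  shows "compact_op S"
proof (rule compact_opI_approx[OF S])
  fix \<epsilon> :: real assume \<epsilon>: "\<epsilon> > 0"
  interpret S: bounded_linear S by (rule bounded_clinear_imp_bounded_linear[OF S])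
  have "\<exists>F. finite F \<and> (\<forall>x y. (\<forall>w\<in>F. cinner x w = 0 \<and> cinner y w = 0) \<longrightarrow>
      cmod (cinner (S x) y) \<le> \<epsilon> * norm x * norm y)"
  proof (rule ccontr)
    assume neg: "\<not> ?thesis"
    \<comment> \<open>Failure for every finite set provides unit vectors orthogonal to all those
      chosen before, so the recursion can always continue.\<close>
    have step: "\<exists>x y. norm x = 1 \<and> norm y = 1 \<and> (\<forall>w\<in>F. cinner x w = 0 \<and> cinner y w = 0) \<and>
        \<epsilon> < cmod (cinner (S x) y)" if F: "finite F" for F
    proof -
      obtain x y where xy: "\<forall>w\<in>F. cinner x w = 0 \<and> cinner y w = 0"
        "\<epsilon> * norm x * norm y < cmod (cinner (S x) y)" using neg F by (meson not_le)
      have x0: "x \<noteq> 0" and y0: "y \<noteq> 0" using xy(2) by (auto simp: S.zero)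
      let ?x = "(1 / norm x) *\<^sub>R x" and ?y = "(1 / norm y) *\<^sub>R y"
      have "cmod (cinner (S ?x) ?y) = cmod (cinner (S x) y) / (norm x * norm y)"
        by (simp add: S.scaleR cinner.scaleR_left cinner.scaleR_right)
      moreover have "\<epsilon> < cmod (cinner (S x) y) / (norm x * norm y)"
        using xy(2) x0 y0 by (simp add: less_divide_eq mult.assoc)
      ultimately show ?thesis
        using xy(1) x0 y0
        by (intro exI[of _ ?x] exI[of _ ?y]) (simp add: cinner.scaleR_left)
    qed
    define Q where "Q f n r \<longleftrightarrow> norm (fst r) = 1 \<and> norm (snd r) = 1 \<and>
      (\<forall>i<n. cinner (fst r) (fst (f i)) = 0 \<and> cinner (snd r) (snd (f i)) = 0) \<and>
      \<epsilon> < cmod (cinner (S (fst r)) (snd r))" for f :: "nat \<Rightarrow> 'a \<times> 'a" and n r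
    have "\<exists>f. \<forall>n. Q f n (f n)"
    proof (rule dependent_wellorder_choice)
      fix r :: "'a \<times> 'a" and f g :: "nat \<Rightarrow> 'a \<times> 'a" and n :: nat
      assume "\<And>y. y < n \<Longrightarrow> f y = g y"
      then show "Q f n r = Q g n r" by (simp add: Q_def)
    next
      fix n :: nat and f :: "nat \<Rightarrow> 'a \<times> 'a"
      have "finite ((\<lambda>i. fst (f i)) ` {..<n} \<union> (\<lambda>i. snd (f i)) ` {..<n})" by simp
      from step[OF this] obtain x y where "norm x = 1" "norm y = 1" "\<epsilon> < cmod (cinner (S x) y)"
        "\<forall>w\<in>(\<lambda>i. fst (f i)) ` {..<n} \<union> (\<lambda>i. snd (f i)) ` {..<n}. cinner x w = 0 \<and> cinner y w = 0"
        by metis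
      then show "\<exists>r. Q f n r" by (intro exI[of _ "(x, y)"]) (auto simp: Q_def)
    qed
    then obtain f where f: "\<And>n. Q f n (f n)" by blast
    have on: "on_seq (\<lambda>n. h (f n))" if h: "h = fst \<or> h = snd" for h
      unfolding on_seq_def
    proof (intro conjI allI impI)
      have lt: "cinner (h (f i)) (h (f j)) = 0" if "j < i" for i j
        using f[of i] h that by (auto simp: Q_def)
      show "cinner (h (f i)) (h (f j)) = 0" if "i \<noteq> j" for i j
        using that lt cinner_zero_commute by (metis linorder_neqE_nat)
      show "h (f i) = 0 \<or> norm (h (f i)) = 1" for i using f[of i] h by (auto simp: Q_def)
    qed
    have le: "real N * \<epsilon> powr p \<le> C" for N
    proof -
      have "real N * \<epsilon> powr p = (\<Sum>k<N. \<epsilon> powr p)" by simp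
      also have "\<dots> \<le> (\<Sum>k<N. cmod (cinner (S (fst (f k))) (snd (f k))) powr p)"
        using f \<epsilon> p by (intro sum_mono powr_mono2) (auto simp: Q_def less_imp_le)
      also have "\<dots> \<le> C" using bound[OF on on] by blast
      finally show ?thesis .
    qed
    have "0 < \<epsilon> powr p" using \<epsilon> by simp
    then obtain N :: nat where "C < real N * \<epsilon> powr p" using reals_Archimedean3 by blast
    with le[of N] show False by linarith
  qed
  then obtain F where F: "finite F" and small: "\<And>x y. (\<forall>w\<in>F. cinner x w = 0 \<and> cinner y w = 0) \<Longrightarrow>
      cmod (cinner (S x) y) \<le> \<epsilon> * norm x * norm y" by blast
  obtain G where G: "finite G" "orthonormal G" "F \<subseteq> cspan G" by (rule gram_schmidt[OF F])
  obtain L where L: "L > 0" "\<And>x. norm (S x) \<le> L * norm x" using bounded_clinear_pos_bound[OF S] by metis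
  \<comment> \<open>With q = x - P x, the vector S x splits into S (P x), P (S q) and w = S q - P (S
    q). The first lies in \<open>?K2\<close>, the second in \<open>?K1\<close>, and w is compressed
    to the complement of \<open>G\<close> on both sides, where the form is small.\<close>
  let ?P = "proj_onto G"
  let ?K1 = "{\<Sum>g\<in>G. c g *\<^sub>C g | c. \<forall>g\<in>G. cmod (c g) \<le> L}"
  let ?K2 = "{\<Sum>g\<in>G. c g *\<^sub>C S g | c. \<forall>g\<in>G. cmod (c g) \<le> 1}"
  have "compact {x + y | x y. x \<in> ?K1 \<and> y \<in> ?K2}"
    using compact_combinations[OF G(1), of "\<lambda>g. g" L] compact_combinations[OF G(1), of S 1]
    by (rule compact_sums)
  moreover have "\<exists>k\<in>{x + y | x y. x \<in> ?K1 \<and> y \<in> ?K2}. norm (S x - k) \<le> \<epsilon>" if x: "norm x \<le> 1" for x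
  proof (rule bexI)
    define q where "q = x - ?P x"
    define w where "w = S q - ?P (S q)"
    have cg: "cmod (cinner z g) \<le> norm z" if "g \<in> G" for z g
      using norm_cinner_le[of z g] orthonormal_norm[OF G(2) that] by simp
    have q1: "norm q \<le> norm x" unfolding q_def by (rule norm_proj_onto_le(2)[OF G(1,2)])
    have "norm (S q) \<le> L * norm q" by (rule L(2))
    also have "\<dots> \<le> L * 1" using q1 x L(1) by (intro mult_left_mono) auto
    finally have Sq: "norm (S q) \<le> L" by simp
    have "?P (S q) \<in> ?K1"
      unfolding proj_onto_def using cg Sq by (intro CollectI exI[of _ "\<lambda>g. cinner (S q) g"]) (auto intro: order_trans[OF cg])
    moreover have "S (?P x) \<in> ?K2"
      unfolding proj_onto_def S.sum bounded_clinear_scaleC[OF S]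
      using cg x by (intro CollectI exI[of _ "\<lambda>g. cinner x g"]) (auto intro: order_trans[OF cg])
    ultimately show "?P (S q) + S (?P x) \<in> {x + y | x y. x \<in> ?K1 \<and> y \<in> ?K2}" by blast
    have orth: "\<forall>z\<in>F. cinner q z = 0 \<and> cinner w z = 0"
      using proj_onto_diff_orthogonal[OF G(1,2)] G(3) unfolding q_def w_def by blast
    have "cinner (?P (S q)) w = 0"
      using proj_onto_diff_orthogonal[OF G(1,2) proj_onto_in_cspan, of "S q" "S q"]
      unfolding w_def by (metis cinner_zero_commute)
    \<comment> \<open>Testing w against itself reduces its norm to a value <S q, w> of the form with
      both arguments orthogonal to \<open>F\<close>.\<close>
    then have "cinner w w = cinner (S q) w" by (metis w_def cinner.diff_left diff_zero)
    then have "(norm w)\<^sup>2 = cmod (cinner (S q) w)" by (metis cinner_self norm_of_real abs_power2)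
    also have "\<dots> \<le> \<epsilon> * norm q * norm w" by (rule small[OF orth])
    finally have "norm w * norm w \<le> (\<epsilon> * norm q) * norm w" by (simp add: power2_eq_square)
    then have "norm w \<le> \<epsilon> * norm q"
      using \<epsilon> by (cases "w = 0") (auto simp: mult_le_cancel_right)
    also have "\<dots> \<le> \<epsilon> * 1" using q1 x \<epsilon> by (intro mult_left_mono) auto
    finally have "norm w \<le> \<epsilon>" by simp
    moreover have "S x - (?P (S q) + S (?P x)) = w"
      unfolding w_def by (simp add: q_def S.diff)
    ultimately show "norm (S x - (?P (S q) + S (?P x))) \<le> \<epsilon>" by simp
  qed
  ultimately show "\<exists>K. compact K \<and> (\<forall>x. norm x \<le> 1 \<longrightarrow> (\<exists>k\<in>K. norm (S x - k) \<le> \<epsilon>))"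
    by (intro exI conjI allI impI)
qed

lemma quadratic_bound_imp_schatten:
  fixes S :: "'a::chilbert_space \<Rightarrow> 'a"
  assumes p: "1 \<le> p" and S: "bounded_clinear S"
    and quad: "\<And>e N. on_seq e \<Longrightarrow> (\<Sum>k<N. cmod (cinner (S (e k)) (e k)) powr p) \<le> C"
  shows "S \<in> schatten p"
proof -
  have bil: "(\<Sum>k<N. cmod (cinner (S (u k)) (v k)) powr p) \<le> 2 powr p * (C + C)"
    if "on_seq u" "on_seq v" for u v N
    by (rule quadratic_bound_imp_bilinear_bound[OF p S _ that]) (rule quad)
  have co: "compact_op S" by (rule bilinear_bound_imp_compact_op[OF S _ p]) (rule bil)
  obtain s u v where svd: "svd S s u v" by (rule compact_op_svd[OF co])
  have on: "on_seq u" "on_seq v" and s0: "\<And>n. 0 \<le> s n" using svd by (auto simp: svd_def)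
  have "cmod (cinner (S (u k)) (v k)) = s k" for k
    using cinner_svd_right[OF S svd, of "u k" k] on_seq_cinner_self[OF on(1), of k]
      svd_eq_0_iff[OF svd, of k] s0[of k] by (simp add: norm_mult split: if_splits)
  then have "(\<Sum>k<N. s k powr p) \<le> 2 powr p * (C + C)" for N using bil[OF on] by simp
  then have "summable (\<lambda>n. s n powr p)" by (intro summableI_nonneg_bounded) auto
  then show ?thesis using schatten_iff_svd_summable[OF co svd] by simp
qed

theorem theorem8:
  fixes S :: "'a::chilbert_space \<Rightarrow> 'a" and p :: real
  assumes separable: "\<exists>D::'a set. countable D \<and> closure D = UNIV"
    and p: "1 \<le> p"
    and S: "bounded_clinear S"
  shows "(S \<in> schatten p \<longleftrightarrow>
           (\<exists>C>0. \<forall>B. is_onb B \<longrightarrow>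
              (\<lambda>e. cmod (cinner (S e) e) powr p) summable_on B \<and>
              (\<Sum>\<^sub>\<infinity>e\<in>B. cmod (cinner (S e) e) powr p) \<le> C))
       \<and> ((\<exists>C>0. \<forall>B. is_onb B \<longrightarrow>
              (\<lambda>e. cmod (cinner (S e) e) powr p) summable_on B \<and>
              (\<Sum>\<^sub>\<infinity>e\<in>B. cmod (cinner (S e) e) powr p) \<le> C)
          \<longleftrightarrow>
          (\<exists>C>0. \<forall>f. is_frame f \<and> upper_frame_bound f \<le> 1 \<longrightarrow>
              summable (\<lambda>n. cmod (cinner (S (f n)) (f n)) powr p) \<and>
              (\<Sum>n. cmod (cinner (S (f n)) (f n)) powr p) \<le> C))"
proof -
  define h where "h = (\<lambda>x. cmod (cinner (S x) x) powr p)"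
  have h0: "0 \<le> h x" for x by (simp add: h_def)
  let ?ii = "\<exists>C>0. \<forall>B. is_onb B \<longrightarrow> h summable_on B \<and> (\<Sum>\<^sub>\<infinity>e\<in>B. h e) \<le> C"
  let ?iii = "\<exists>C>0. \<forall>f. is_frame f \<and> upper_frame_bound f \<le> 1 \<longrightarrow>
    summable (\<lambda>n. h (f n)) \<and> (\<Sum>n. h (f n)) \<le> C"
  have 1: ?iii if i: "S \<in> schatten p"
  proof -
    obtain M where M: "\<And>f K. bessel_seq f \<Longrightarrow> (\<Sum>k<K. h (f k)) \<le> M"
      unfolding h_def by (rule schatten_bessel_seq_bound[OF p i]) blast
    \<comment> \<open>The maximum with 1 makes the constant positive even when \<open>M\<close> is
      0.\<close>
    have "summable (\<lambda>n. h (f n)) \<and> (\<Sum>n. h (f n)) \<le> max M 1"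
      if f: "is_frame f \<and> upper_frame_bound f \<le> 1" for f
    proof -
      have le: "(\<Sum>k<K. h (f k)) \<le> M" for K using f by (intro M frame_imp_bessel_seq) auto
      then have "summable (\<lambda>n. h (f n))" by (intro summableI_nonneg_bounded h0)
      moreover from this have "(\<Sum>n. h (f n)) \<le> M" using le by (rule suminf_le_const)
      ultimately show ?thesis by simp
    qed
    then show ?thesis by (intro exI[of _ "max M 1"]) simp
  qed
  have 2: ?ii if iii: ?iii
  proof -
    obtain C where C: "C > 0" "\<forall>f. is_frame f \<and> upper_frame_bound f \<le> 1 \<longrightarrow>
        summable (\<lambda>n. h (f n)) \<and> (\<Sum>n. h (f n)) \<le> C" using iii by blast
    have "h summable_on B \<and> (\<Sum>\<^sub>\<infinity>e\<in>B. h e) \<le> C" if "is_onb B" for B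
      by (rule onb_sum_le_frame[OF separable _ h0 that]) (simp add: C(2))
    with C(1) show ?thesis by blast
  qed
  have 3: "S \<in> schatten p" if ii: ?ii
  proof -
    obtain C where C: "\<forall>B. is_onb B \<longrightarrow> h summable_on B \<and> (\<Sum>\<^sub>\<infinity>e\<in>B. h e) \<le> C" using ii by blast
    have "h 0 = 0" by (simp add: h_def)
    then have "(\<Sum>k<N. h (e k)) \<le> C" if "on_seq e" for e N
      by (intro on_seq_finite_sum_le_onb[OF separable _ h0 _ that]) (simp_all add: C)
    then show ?thesis by (intro quadratic_bound_imp_schatten[OF p S]) (simp add: h_def)
  qed
  from 1 2 3 have "(S \<in> schatten p \<longleftrightarrow> ?ii) \<and> (?ii \<longleftrightarrow> ?iii)" by blast
  then show ?thesis unfolding h_def .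
qed

end
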